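(* Let $k$ be a field and let $I$ be a monomial ideal in $k[x_1,\ldots,x_r]$ without embedded primes. Then $\operatorname{sdef}_I(n) = O(n^{r-2})$ as $n\to\infty$.
   Context: Let $R = k[x_1,\ldots,x_r]$ and $\mathfrak m = (x_1,\ldots,x_r)$. For an ideal $I$ of $R$, the $n$-th symbolic power is $I^{(n)} := \bigcap_{\mathfrak p \in \operatorname{Ass}(R/I)} (I^n R_{\mathfrak p} \cap R)$, the intersection being over all associated primes of $R/I$. For a finitely generated graded $R$-module $M$, $\mu(M) = \dim_k (M/\mathfrak m M)$ denotes its minimal number of generators. The symbolic defect function of $I$ is $\operatorname{sdef}_I(n) := \mu\left(I^{(n)}/I^n\right)$. "Without embedded primes" means that every associated prime of $R/I$ is minimal over $I$. For functions $f,g$ of $n$, $f(n)=O(g(n))$ means $\limsup_{n\to\infty} f(n)/g(n) < \infty$. *)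

theory Defs
  imports
    "HOL-Algebra.Ideal_Product"
    "HOL-Algebra.QuotRing"
    "HOL-Algebra.Algebraic_Closure_Type"
    "HOL-Computational_Algebra.Fraction_Field"
    "HOL-Library.Cardinality"
    "HOL-Library.Poly_Mapping"
    "HOL-Library.Landau_Symbols"
    "Jordan_Normal_Form.Missing_VectorSpace"
begin

section \<open>Modules and primes over a commutative ring\<close>

text \<open>An ideal (or any additive subgroup closed under multiplication by \<open>R\<close>) as an \<open>R\<close>-module.\<close>

definition ideal_module :: "('a, 'c) ring_scheme \<Rightarrow> 'a set \<Rightarrow> ('a, 'a) module" where
  "ideal_module R A =
    \<lparr>carrier = A, monoid.mult = monoid.mult R, one = one R, ring.zero = ring.zero R, add = add R,
     module.smult = monoid.mult R\<rparr>"

text \<open>The quotient module \<open>M / N\<close>, on cosets. The fields \<open>mult\<close> and \<open>one\<close> of the record type are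
  irrelevant for modules and get dummy values.\<close>

definition quot_module :: "('a, 'm, 'c) module_scheme \<Rightarrow> 'm set \<Rightarrow> ('a, 'm set) module" where
  "quot_module M N =
    \<lparr>carrier = a_rcosets\<^bsub>M\<^esub> N, monoid.mult = (\<lambda>_ _. N), one = N, ring.zero = N,
     add = set_add M, module.smult = (\<lambda>a C. \<Union>x\<in>C. N +>\<^bsub>M\<^esub> (a \<odot>\<^bsub>M\<^esub> x))\<rparr>"

definition restrict_scalars :: "('k \<Rightarrow> 'a) \<Rightarrow> ('a, 'm, 'c) module_scheme \<Rightarrow> ('k, 'm) module" where
  "restrict_scalars \<phi> M =
    \<lparr>carrier = carrier M, monoid.mult = monoid.mult M, one = one M, ring.zero = ring.zero M,
     add = add M, module.smult = (\<lambda>c x. \<phi> c \<odot>\<^bsub>M\<^esub> x)\<rparr>"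

text \<open>The submodule \<open>J M\<close> of \<open>M\<close>.\<close>

definition ideal_smult ::
    "('a, 'b) ring_scheme \<Rightarrow> 'a set \<Rightarrow> ('a, 'm, 'c) module_scheme \<Rightarrow> 'm set" where
  "ideal_smult R J M = module.span R M {a \<odot>\<^bsub>M\<^esub> x | a x. a \<in> J \<and> x \<in> carrier M}"

definition assoc_primes ::
    "('a, 'b) ring_scheme \<Rightarrow> ('a, 'm, 'c) module_scheme \<Rightarrow> 'a set set" where
  "assoc_primes R M =
    {P. primeideal P R \<and> (\<exists>x\<in>carrier M. P = {a \<in> carrier R. a \<odot>\<^bsub>M\<^esub> x = \<zero>\<^bsub>M\<^esub>})}"

text \<open>\<open>Ass (R / I)\<close>, where \<open>R / I\<close> is regarded as an \<open>R\<close>-module.\<close>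

definition Ass :: "('a, 'b) ring_scheme \<Rightarrow> 'a set \<Rightarrow> 'a set set" where
  "Ass R I = assoc_primes R (quot_module (ideal_module R (carrier R)) I)"

definition minimal_prime_over :: "('a, 'b) ring_scheme \<Rightarrow> 'a set \<Rightarrow> 'a set \<Rightarrow> bool" where
  "minimal_prime_over R I P \<longleftrightarrow>
    primeideal P R \<and> I \<subseteq> P \<and> (\<forall>Q. primeideal Q R \<and> I \<subseteq> Q \<and> Q \<subseteq> P \<longrightarrow> Q = P)"

definition without_embedded_primes :: "('a, 'b) ring_scheme \<Rightarrow> 'a set \<Rightarrow> bool" where
  "without_embedded_primes R I \<longleftrightarrow> (\<forall>P\<in>Ass R I. minimal_prime_over R I P)"

text \<open>The power \<open>I\<^sup>n\<close> in the multiplicative monoid of ideals; in particular \<open>I\<^sup>0 = R\<close>.\<close>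

definition ideal_power :: "('a, 'b) ring_scheme \<Rightarrow> 'a set \<Rightarrow> nat \<Rightarrow> 'a set" where
  "ideal_power R I n = I [^]\<^bsub>ideals_set R\<^esub> n"


section \<open>Localization of an integral domain at a prime\<close>

text \<open>For a domain \<open>R\<close> (here a type of class \<open>idom\<close>), the localization \<open>R\<^sub>P\<close> is the subring of the
  fraction field consisting of the fractions with denominator outside \<open>P\<close>, and \<open>R\<close> is embedded in it
  by \<open>f \<mapsto> f / 1\<close>.\<close>

definition localization :: "'a::idom set \<Rightarrow> 'a fract ring" where
  "localization P = ring_of_type_algebra \<lparr>carrier := {Fract a s | a s. s \<notin> P}\<rparr>"

definition to_fract :: "'a::idom \<Rightarrow> 'a fract" where
  "to_fract f = Fract f 1"

definition extend_ideal :: "'a::idom set \<Rightarrow> 'a set \<Rightarrow> 'a fract set" where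
  "extend_ideal P J = Idl\<^bsub>localization P\<^esub> (to_fract ` J)"

text \<open>\<open>J R\<^sub>P \<inter> R\<close>\<close>

definition localize_contract :: "'a::idom set \<Rightarrow> 'a set \<Rightarrow> 'a set" where
  "localize_contract P J = to_fract -` extend_ideal P J"

text \<open>If \<open>I\<close> is the unit ideal, then there are no associated primes and the intersection is
  the whole ring.\<close>

definition symbolic_power :: "'a::idom set \<Rightarrow> nat \<Rightarrow> 'a set" where
  "symbolic_power I n =
    (\<Inter>P \<in> Ass ring_of_type_algebra I. localize_contract P (ideal_power ring_of_type_algebra I n))"


section \<open>Polynomial rings and the symbolic defect\<close>

text \<open>Polynomials over \<open>'k\<close> in variables indexed by \<open>'n\<close>, as finitely supported functions from
  exponent vectors to coefficients. The linear order on the index type is only needed for the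
  library to recognise the polynomials as an integral domain.\<close>

type_synonym ('n, 'k) mpoly = "('n \<Rightarrow>\<^sub>0 nat) \<Rightarrow>\<^sub>0 'k"

abbreviation polyR :: "('n::{finite, linorder}, 'k::field) mpoly ring" where
  "polyR \<equiv> ring_of_type_algebra"

definition const :: "'k::field \<Rightarrow> ('n::{finite, linorder}, 'k) mpoly" where
  "const c = Poly_Mapping.single 0 c"

definition monomial :: "('n::{finite, linorder} \<Rightarrow>\<^sub>0 nat) \<Rightarrow> ('n, 'k::field) mpoly" where
  "monomial t = Poly_Mapping.single t 1"

definition var :: "'n::{finite, linorder} \<Rightarrow> ('n, 'k::field) mpoly" where
  "var i = monomial (Poly_Mapping.single i 1)"

definition irrelevant_ideal :: "('n::{finite, linorder}, 'k::field) mpoly set" where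
  "irrelevant_ideal = Idl\<^bsub>polyR\<^esub> (range var)"

definition monomial_ideal :: "('n::{finite, linorder}, 'k::field) mpoly set \<Rightarrow> bool" where
  "monomial_ideal I \<longleftrightarrow> (\<exists>T. I = Idl\<^bsub>polyR\<^esub> (monomial ` T))"

text \<open>\<open>\<mu> M\<close> is the \<open>k\<close>-dimension of \<open>M / \<mm>M\<close>, where \<open>k\<close> acts through the constant polynomials.\<close>

definition \<mu> :: "(('n::{finite, linorder}, 'k::field) mpoly, 'm, 'c) module_scheme \<Rightarrow> nat" where
  "\<mu> M = vectorspace.dim (ring_of_type_algebra :: 'k ring)
    (restrict_scalars const (quot_module M (ideal_smult polyR irrelevant_ideal M)))"

definition sdef :: "('n::{finite, linorder}, 'k::field) mpoly set \<Rightarrow> nat \<Rightarrow> nat" where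
  "sdef I n = \<mu> (quot_module (ideal_module polyR (symbolic_power I n)) (ideal_power polyR I n))"

end

theory Submission
  imports Defs
begin

text \<open>
  A monomial ideal is the span of the monomials whose exponents lie in an up-set \<open>U \<subseteq> \<nat>\<^sup>r\<close>. Without
  embedded primes, every associated prime is minimal over \<open>I\<close>, hence of the form
  \<open>(x\<^sub>i : i \<in> S)\<close>, and localizing at it and contracting amounts to setting the variables outside \<open>S\<close>
  to \<open>1\<close>: the exponents of \<open>I\<^sup>n R\<^sub>P \<inter> R\<close> are the set \<open>sat S U\<^sub>n\<close> of those \<open>t\<close> which reach the exponent
  set \<open>U\<^sub>n\<close> of \<open>I\<^sup>n\<close> by adding a vector that vanishes on \<open>S\<close> (\<open>localize_contract_supported\<close>). So \<open>I\<^sup>(\<^sup>n\<^sup>)\<close> is again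
  monomial, with exponent set \<open>W\<^sub>n = \<Inter>\<^sub>S sat S U\<^sub>n\<close>, and \<open>sdef I n\<close> is at most the number of minimal
  elements of \<open>W\<^sub>n\<close> (\<open>\<mu>_quotient_le_card\<close>).

  If the irrelevant ideal is associated, then, being minimal, it is the only associated prime, so
  \<open>I\<^sup>(\<^sup>n\<^sup>) = I\<^sup>n\<close> and the defect vanishes. Otherwise each \<open>S\<close> misses some coordinate, and this saves two
  dimensions in the count. Let \<open>a \<noteq> 0\<close> be minimal in \<open>W\<^sub>n\<close>. Some \<open>a\<^sub>i\<close> is positive, and \<open>a - e\<^sub>i\<close>
  leaves \<open>sat S U\<^sub>n\<close> for some \<open>S\<close>, necessarily with \<open>i \<in> S\<close>. Choose \<open>j \<notin> S\<close>; either \<open>a\<^sub>j = 0\<close>, or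
  \<open>a - e\<^sub>j\<close> leaves \<open>sat S' U\<^sub>n\<close> for some \<open>S'\<close>. Membership in \<open>sat S U\<^sub>n\<close> is insensitive to the
  coordinate \<open>j\<close>, so the coordinates other than \<open>i, j\<close> determine \<open>a\<^sub>i\<close>, and then all coordinates other
  than \<open>j\<close> determine \<open>a\<^sub>j\<close> (\<open>card_doubly_tight\<close>). Finally \<open>a\<^sub>k \<le> D n\<close> for a constant \<open>D\<close>, because by
  minimality of \<open>P\<close> a power of each variable of \<open>P\<close> lies in \<open>I R\<^sub>P\<close>
  (\<open>minimal_coord_prime_pure_power\<close>). Hence there are \<open>O((D n + 1)\<^sup>r\<^sup>-\<^sup>2)\<close> minimal elements.

  For \<open>r = 1\<close> the bound \<open>n\<^sup>-\<^sup>1\<close> forces the defect to vanish for large \<open>n\<close>. The same count gives this,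
  since no pair \<open>i \<noteq> j\<close> exists, provided that a proper ideal has an associated prime at all
  (\<open>Ass_nonempty\<close>); otherwise \<open>W\<^sub>n\<close> would be everything, with the minimal element \<open>0\<close>.
\<close>

section \<open>Ideals and localizations of a commutative ring given as a type\<close>

lemma ring_of_type_algebra_simps [simp]:
  "carrier ring_of_type_algebra = UNIV"
  "a \<otimes>\<^bsub>ring_of_type_algebra\<^esub> b = a * b"
  "\<one>\<^bsub>ring_of_type_algebra\<^esub> = 1"
  "\<zero>\<^bsub>ring_of_type_algebra\<^esub> = 0"
  "a \<oplus>\<^bsub>ring_of_type_algebra\<^esub> b = a + b"
  by (simp_all add: ring_of_type_algebra_def)

lemma ideal_ring_of_type_iff:
  fixes J :: "'a::comm_ring_1 set"
  shows "ideal J ring_of_type_algebra \<longleftrightarrow>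
    0 \<in> J \<and> (\<forall>a\<in>J. \<forall>b\<in>J. a + b \<in> J) \<and> (\<forall>r. \<forall>a\<in>J. r * a \<in> J)"
proof
  assume "ideal J ring_of_type_algebra"
  then interpret ideal J "ring_of_type_algebra :: 'a ring" .
  show "0 \<in> J \<and> (\<forall>a\<in>J. \<forall>b\<in>J. a + b \<in> J) \<and> (\<forall>r. \<forall>a\<in>J. r * a \<in> J)"
  proof (intro conjI ballI allI)
    show "0 \<in> J"
      by (rule additive_subgroup.zero_closed[OF is_additive_subgroup, unfolded ring_of_type_algebra_simps])
    show "a + b \<in> J" if "a \<in> J" "b \<in> J" for a b
      by (rule additive_subgroup.a_closed[OF is_additive_subgroup,
            unfolded ring_of_type_algebra_simps, OF that])
    show "r * a \<in> J" if "a \<in> J" for r a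
      by (rule I_l_closed[unfolded ring_of_type_algebra_simps, OF that UNIV_I])
  qed
next
  assume J: "0 \<in> J \<and> (\<forall>a\<in>J. \<forall>b\<in>J. a + b \<in> J) \<and> (\<forall>r. \<forall>a\<in>J. r * a \<in> J)"
  interpret R: cring "ring_of_type_algebra :: 'a ring"
    by (rule cring_from_type_algebra)
  have minus: "\<ominus>\<^bsub>ring_of_type_algebra\<^esub> a = - a" for a :: 'a
    using R.minus_equality[of "- a" a] by simp
  have neg: "- a \<in> J" if "a \<in> J" for a
    using J that mult_minus1[of a] by metis
  have "subgroup J (add_monoid (ring_of_type_algebra :: 'a ring))"
    by (rule R.add.subgroupI) (use J minus neg in auto)
  moreover have "a * r \<in> J" if "a \<in> J" for a r
    using J that by (metis mult.commute)
  ultimately show "ideal J ring_of_type_algebra"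
    using J by (intro idealI[OF R.ring_axioms]) auto
qed

lemma primeideal_ring_of_type_iff:
  fixes P :: "'a::comm_ring_1 set"
  shows "primeideal P ring_of_type_algebra \<longleftrightarrow>
    ideal P ring_of_type_algebra \<and> 1 \<notin> P \<and> (\<forall>a b. a * b \<in> P \<longrightarrow> a \<in> P \<or> b \<in> P)"
proof
  assume "primeideal P ring_of_type_algebra"
  then interpret primeideal P "ring_of_type_algebra :: 'a ring" .
  have "1 \<notin> P"
    using I_notcarr one_imp_carrier by auto
  then show "ideal P ring_of_type_algebra \<and> 1 \<notin> P \<and> (\<forall>a b. a * b \<in> P \<longrightarrow> a \<in> P \<or> b \<in> P)"
    using I_prime is_ideal by simp
next
  assume P: "ideal P ring_of_type_algebra \<and> 1 \<notin> P \<and> (\<forall>a b. a * b \<in> P \<longrightarrow> a \<in> P \<or> b \<in> P)"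
  show "primeideal P ring_of_type_algebra"
    by (rule primeidealI) (use P cring_from_type_algebra in auto)
qed

lemma prime_ideal_zero_mem:
  fixes P :: "'a::comm_ring_1 set"
  assumes "primeideal P ring_of_type_algebra"
  shows "0 \<in> P"
  using assms by (simp add: primeideal_ring_of_type_iff ideal_ring_of_type_iff)

lemma ring_localization:
  fixes P :: "'a::idom set"
  assumes P: "primeideal P ring_of_type_algebra"
  shows "ring (localization P)"
proof -
  let ?F = "ring_of_type_algebra :: 'a fract ring"
  let ?L = "{Fract a s | a s. s \<notin> P}"
  interpret F: cring ?F
    by (rule cring_from_type_algebra)
  have nz: "s \<noteq> 0" if "s \<notin> P" for s
    using that prime_ideal_zero_mem[OF P] by auto
  have mult: "s * t \<notin> P" if "s \<notin> P" "t \<notin> P" for s t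
    using P that by (auto simp: primeideal_ring_of_type_iff)
  have minus: "\<ominus>\<^bsub>?F\<^esub> x = - x" for x :: "'a fract"
    using F.minus_equality[of "- x" x] by simp
  have one: "1 \<notin> P"
    using P by (simp add: primeideal_ring_of_type_iff)
  have "subring ?L ?F"
  proof (rule F.subringI)
    show "\<one>\<^bsub>?F\<^esub> \<in> ?L"
      using one by (auto simp: One_fract_def)
  next
    fix x assume "x \<in> ?L"
    then obtain a s where "x = Fract a s" "s \<notin> P" by blast
    then have "- x = Fract (- a) s" by simp
    then show "\<ominus>\<^bsub>?F\<^esub> x \<in> ?L"
      unfolding minus using \<open>s \<notin> P\<close> by blast
  next
    fix x y assume "x \<in> ?L" "y \<in> ?L"
    then obtain a s b t where x: "x = Fract a s" "s \<notin> P" "y = Fract b t" "t \<notin> P" by blast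
    then show "x \<otimes>\<^bsub>?F\<^esub> y \<in> ?L"
      using mult by auto
    show "x \<oplus>\<^bsub>?F\<^esub> y \<in> ?L"
      using mult x nz by (auto simp: add_fract)
  qed auto
  then show ?thesis
    unfolding localization_def by (rule subring.axioms F.subring_is_ring)
qed

text \<open>The fractions \<open>a / s\<close> with \<open>a \<in> J\<close> and \<open>s \<notin> P\<close> already form an ideal of the localization, so
  membership in \<open>J R\<^sub>P \<inter> R\<close> is witnessed by a single denominator.\<close>

lemma localize_contract_eq:
  fixes P J :: "'a::idom set"
  assumes P: "primeideal P ring_of_type_algebra"
    and J: "ideal J ring_of_type_algebra"
  shows "localize_contract P J = {f. \<exists>s. s \<notin> P \<and> s * f \<in> J}"
proof -
  let ?E = "{Fract a s | a s. a \<in> J \<and> s \<notin> P}"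
  interpret L: ring "localization P"
    by (rule ring_localization[OF P])
  have L_simps [simp]: "carrier (localization P) = {Fract a s | a s. s \<notin> P}"
    "\<And>x y. x \<otimes>\<^bsub>localization P\<^esub> y = x * y" "\<And>x y. x \<oplus>\<^bsub>localization P\<^esub> y = x + y"
    "\<zero>\<^bsub>localization P\<^esub> = 0"
    by (simp_all add: localization_def ring_of_type_algebra_def)
  have nz: "s \<noteq> 0" if "s \<notin> P" for s
    using that prime_ideal_zero_mem[OF P] by auto
  have mult: "s * t \<notin> P" if "s \<notin> P" "t \<notin> P" for s t
    using P that by (auto simp: primeideal_ring_of_type_iff)
  have one: "1 \<notin> P"
    using P by (simp add: primeideal_ring_of_type_iff)
  have J0: "0 \<in> J" and Jadd: "\<And>a b. a \<in> J \<Longrightarrow> b \<in> J \<Longrightarrow> a + b \<in> J"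
    and Jmult: "\<And>r a. a \<in> J \<Longrightarrow> r * a \<in> J"
    using J by (auto simp: ideal_ring_of_type_iff)
  have minus: "\<ominus>\<^bsub>localization P\<^esub> Fract a s = Fract (- a) s" if "s \<notin> P" for a s
    using that by (intro L.minus_equality) (auto simp: nz add_fract eq_fract Zero_fract_def)
  have ideal_E: "ideal ?E (localization P)"
  proof (rule idealI[OF L.ring_axioms])
    show "subgroup ?E (add_monoid (localization P))"
    proof (rule L.add.subgroupI)
      show "?E \<noteq> {}" using J0 one by blast
    next
      fix x assume "x \<in> ?E"
      then obtain a s where "x = Fract a s" "a \<in> J" "s \<notin> P" by blast
      then show "\<ominus>\<^bsub>localization P\<^esub> x \<in> ?E"
        using minus Jmult[of a "- 1"] by auto
    next
      fix x y assume "x \<in> ?E" "y \<in> ?E"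
      then obtain a s b t where "x = Fract a s" "a \<in> J" "s \<notin> P" "y = Fract b t" "b \<in> J" "t \<notin> P"
        by blast
      moreover from this have "x + y = Fract (a * t + b * s) (s * t)" "a * t + b * s \<in> J"
        using nz Jadd[OF Jmult[of a t] Jmult[of b s]] by (simp_all add: add_fract mult.commute)
      ultimately show "x \<oplus>\<^bsub>localization P\<^esub> y \<in> ?E"
        using mult by auto
    qed auto
  next
    fix x y assume "x \<in> ?E" "y \<in> carrier (localization P)"
    then obtain a s b t where xy: "x = Fract a s" "a \<in> J" "s \<notin> P" "y = Fract b t" "t \<notin> P"
      by auto
    show "y \<otimes>\<^bsub>localization P\<^esub> x \<in> ?E"
      using mult Jmult[of a b] xy by auto
    show "x \<otimes>\<^bsub>localization P\<^esub> y \<in> ?E"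
      using mult Jmult[of a b] xy by (auto simp: mult.commute)
  qed
  show ?thesis
  proof (intro subset_antisym subsetI)
    fix f assume "f \<in> localize_contract P J"
    moreover have "to_fract ` J \<subseteq> ?E"
      using one by (auto simp: to_fract_def)
    ultimately have "to_fract f \<in> ?E"
      using L.genideal_minimal[OF ideal_E] by (auto simp: localize_contract_def extend_ideal_def)
    then obtain a s where "Fract f 1 = Fract a s" "a \<in> J" "s \<notin> P"
      by (auto simp: to_fract_def)
    then have "s * f \<in> J"
      using nz by (simp add: eq_fract mult.commute)
    then show "f \<in> {f. \<exists>s. s \<notin> P \<and> s * f \<in> J}"
      using \<open>s \<notin> P\<close> by blast
  next
    fix f assume "f \<in> {f. \<exists>s. s \<notin> P \<and> s * f \<in> J}"
    then obtain s where s: "s \<notin> P" "s * f \<in> J" by blast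
    have "to_fract f \<in> K" if K: "ideal K (localization P)" "to_fract ` J \<subseteq> K" for K
    proof -
      interpret K: ideal K "localization P" by (rule K(1))
      have "Fract 1 s \<otimes>\<^bsub>localization P\<^esub> to_fract (s * f) \<in> K"
        by (rule K.I_l_closed) (use K(2) s in auto)
      moreover have "Fract 1 s * to_fract (s * f) = to_fract f"
        using nz[OF s(1)] by (simp add: to_fract_def eq_fract)
      ultimately show ?thesis by simp
    qed
    then show "f \<in> localize_contract P J"
      by (auto simp: localize_contract_def extend_ideal_def genideal_def)
  qed
qed


section \<open>Quotient modules and restriction of scalars\<close>

text \<open>The operations of \<open>quot_module M N\<close> are those for which \<open>x \<mapsto> N + x\<close> is a surjective linear
  map; all module laws are inherited along it.\<close>

lemma
  fixes R :: "('a, 'b) ring_scheme" and M :: "('a, 'm, 'c) module_scheme"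
  assumes M: "module R M" and N: "LinearCombinations.submodule R N M"
  shows module_quot: "module R (quot_module M N)"
    and carrier_quot: "carrier (quot_module M N) = (\<lambda>x. N +>\<^bsub>M\<^esub> x) ` carrier M"
    and zero_quot: "\<zero>\<^bsub>quot_module M N\<^esub> = N"
    and coset_eq_zero: "x \<in> N \<Longrightarrow> N +>\<^bsub>M\<^esub> x = N"
    and coset_eq_zero_iff: "x \<in> carrier M \<Longrightarrow> N +>\<^bsub>M\<^esub> x = N \<longleftrightarrow> x \<in> N"
    and add_quot: "x \<in> carrier M \<Longrightarrow> y \<in> carrier M \<Longrightarrow>
      (N +>\<^bsub>M\<^esub> x) \<oplus>\<^bsub>quot_module M N\<^esub> (N +>\<^bsub>M\<^esub> y) = N +>\<^bsub>M\<^esub> (x \<oplus>\<^bsub>M\<^esub> y)"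
    and smult_quot: "a \<in> carrier R \<Longrightarrow> x \<in> carrier M \<Longrightarrow>
      a \<odot>\<^bsub>quot_module M N\<^esub> (N +>\<^bsub>M\<^esub> x) = N +>\<^bsub>M\<^esub> (a \<odot>\<^bsub>M\<^esub> x)"
proof -
  interpret M: module R M by (rule M)
  interpret N: LinearCombinations.submodule R N M by (rule N)
  have neg: "\<ominus>\<^bsub>M\<^esub> x \<in> N" if "x \<in> N" for x
  proof -
    have "(\<ominus>\<^bsub>R\<^esub> \<one>\<^bsub>R\<^esub>) \<odot>\<^bsub>M\<^esub> x \<in> N" using that by simp
    moreover have "x \<in> carrier M" using that N.subset by blast
    ultimately show ?thesis by (simp add: M.smult_l_minus)
  qed
  have sub: "subgroup N (add_monoid M)"
    using N.subset N.zero_closed neg by (intro M.add.subgroupI) blast+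
  interpret N': abelian_subgroup N M
    by (rule abelian_subgroupI3) (auto intro: additive_subgroupI sub M.abelian_group_axioms)
  show carr: "carrier (quot_module M N) = (\<lambda>x. N +>\<^bsub>M\<^esub> x) ` carrier M"
    by (auto simp: quot_module_def A_RCOSETS_def')
  show zero: "\<zero>\<^bsub>quot_module M N\<^esub> = N"
    by (simp add: quot_module_def)
  have zero': "N = N +>\<^bsub>M\<^esub> \<zero>\<^bsub>M\<^esub>"
    using N.subset by simp
  show coset0: "N +>\<^bsub>M\<^esub> x = N" if "x \<in> N" for x
    using that N.subset by (intro M.a_coset_join2 sub) auto
  show "N +>\<^bsub>M\<^esub> x = N \<longleftrightarrow> x \<in> N" if "x \<in> carrier M" for x
    using that coset0 M.a_coset_join1[OF _ _ sub] by blast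
  show add: "(N +>\<^bsub>M\<^esub> x) \<oplus>\<^bsub>quot_module M N\<^esub> (N +>\<^bsub>M\<^esub> y) = N +>\<^bsub>M\<^esub> (x \<oplus>\<^bsub>M\<^esub> y)"
    if "x \<in> carrier M" "y \<in> carrier M" for x y
    using that N'.a_rcos_sum by (simp add: quot_module_def)
  show smult: "a \<odot>\<^bsub>quot_module M N\<^esub> (N +>\<^bsub>M\<^esub> x) = N +>\<^bsub>M\<^esub> (a \<odot>\<^bsub>M\<^esub> x)"
    if a: "a \<in> carrier R" and x: "x \<in> carrier M" for a x
  proof -
    have "N +>\<^bsub>M\<^esub> (a \<odot>\<^bsub>M\<^esub> y) = N +>\<^bsub>M\<^esub> (a \<odot>\<^bsub>M\<^esub> x)" if y: "y \<in> N +>\<^bsub>M\<^esub> x" for y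
    proof -
      obtain h where h: "h \<in> N" "y = h \<oplus>\<^bsub>M\<^esub> x"
        using y by (auto simp: a_r_coset_def')
      have "h \<in> carrier M" using h N.subset by blast
      then have "a \<odot>\<^bsub>M\<^esub> y = (a \<odot>\<^bsub>M\<^esub> h) \<oplus>\<^bsub>M\<^esub> (a \<odot>\<^bsub>M\<^esub> x)"
        using h a x by (simp add: M.smult_r_distr)
      then have "a \<odot>\<^bsub>M\<^esub> y \<in> N +>\<^bsub>M\<^esub> (a \<odot>\<^bsub>M\<^esub> x)"
        using h a by (auto simp: a_r_coset_def')
      then show ?thesis
        using M.a_repr_independence[OF _ _ sub] a x by auto
    qed
    moreover have "N \<noteq> {}"
      using N.zero_closed by blast
    then have "N +>\<^bsub>M\<^esub> x \<noteq> {}"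
      by (auto simp: a_r_coset_def')
    ultimately show ?thesis by (simp add: quot_module_def)
  qed
  show "module R (quot_module M N)"
  proof (rule module_criteria[OF M.R.is_cring])
    show "\<zero>\<^bsub>quot_module M N\<^esub> \<in> carrier (quot_module M N)"
      unfolding zero carr by (subst zero') auto
    show "\<forall>v\<in>carrier (quot_module M N). v \<oplus>\<^bsub>quot_module M N\<^esub> \<zero>\<^bsub>quot_module M N\<^esub> = v"
    proof
      fix v assume "v \<in> carrier (quot_module M N)"
      then obtain x where x: "x \<in> carrier M" "v = N +>\<^bsub>M\<^esub> x" unfolding carr by blast
      have "v \<oplus>\<^bsub>quot_module M N\<^esub> (N +>\<^bsub>M\<^esub> \<zero>\<^bsub>M\<^esub>) = v"
        unfolding x(2) using x(1) by (subst add) auto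
      then show "v \<oplus>\<^bsub>quot_module M N\<^esub> \<zero>\<^bsub>quot_module M N\<^esub> = v"
        using zero zero' by metis
    qed
    show "\<forall>v\<in>carrier (quot_module M N). \<exists>w\<in>carrier (quot_module M N).
        v \<oplus>\<^bsub>quot_module M N\<^esub> w = \<zero>\<^bsub>quot_module M N\<^esub>"
    proof
      fix v assume "v \<in> carrier (quot_module M N)"
      then obtain x where x: "x \<in> carrier M" "v = N +>\<^bsub>M\<^esub> x" unfolding carr by blast
      have "v \<oplus>\<^bsub>quot_module M N\<^esub> (N +>\<^bsub>M\<^esub> (\<ominus>\<^bsub>M\<^esub> x)) = \<zero>\<^bsub>quot_module M N\<^esub>"
        unfolding x(2) zero using x(1) zero' by (subst add) (auto simp: M.r_neg)
      then show "\<exists>w\<in>carrier (quot_module M N). v \<oplus>\<^bsub>quot_module M N\<^esub> w = \<zero>\<^bsub>quot_module M N\<^esub>"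
        unfolding carr using x(1) by blast
    qed
  qed (auto simp: carr add smult M.a_ac M.smult_l_distr M.smult_r_distr M.smult_assoc1)
qed

lemma module_restrict_scalars:
  fixes K :: "('k, 'd) ring_scheme"
  assumes M: "module R M" and K: "cring K" and \<phi>: "\<phi> \<in> ring_hom K R"
  shows "module K (restrict_scalars \<phi> M)"
proof -
  interpret M: module R M by (rule M)
  have "abelian_group (restrict_scalars \<phi> M)"
    by (rule abelian_groupI)
      (auto simp: restrict_scalars_def M.a_ac intro: M.l_neg M.a_inv_closed)
  then show ?thesis
    by (rule moduleI[OF K])
      (use \<phi> in \<open>auto simp: restrict_scalars_def ring_hom_closed ring_hom_add ring_hom_mult
        ring_hom_one M.smult_l_distr M.smult_r_distr M.smult_assoc1\<close>)
qed

lemma module_ideal_module: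
  fixes A :: "'a::comm_ring_1 set"
  assumes A: "ideal A ring_of_type_algebra"
  shows "module ring_of_type_algebra (ideal_module ring_of_type_algebra A)"
proof (rule module_criteria[OF cring_from_type_algebra])
  have "- a \<in> A" if "a \<in> A" for a
    using A that mult_minus1[of a] unfolding ideal_ring_of_type_iff by metis
  then show "\<forall>v\<in>carrier (ideal_module ring_of_type_algebra A).
      \<exists>w\<in>carrier (ideal_module ring_of_type_algebra A).
        v \<oplus>\<^bsub>ideal_module ring_of_type_algebra A\<^esub> w
          = \<zero>\<^bsub>ideal_module ring_of_type_algebra A\<^esub>"
    by (auto simp: ideal_module_def intro!: bexI[of _ "- _"])
qed (use A in \<open>auto simp: ideal_module_def ideal_ring_of_type_iff algebra_simps\<close>)

lemma submodule_ideal_module: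
  fixes A B :: "'a::comm_ring_1 set"
  assumes "ideal A ring_of_type_algebra" "ideal B ring_of_type_algebra" "B \<subseteq> A"
  shows "LinearCombinations.submodule ring_of_type_algebra B
    (ideal_module ring_of_type_algebra A)"
  by (rule LinearCombinations.submodule.intro[OF module_ideal_module[OF assms(1)]])
    (use assms in \<open>auto simp: ideal_module_def ideal_ring_of_type_iff\<close>)

lemma AssI:
  fixes I P :: "'a::comm_ring_1 set"
  assumes P: "primeideal P ring_of_type_algebra" and I: "ideal I ring_of_type_algebra"
    and x: "P = {a. a * x \<in> I}"
  shows "P \<in> Ass ring_of_type_algebra I"
proof -
  let ?R = "ring_of_type_algebra :: 'a ring"
  let ?M = "ideal_module ?R UNIV"
  have "ideal UNIV ?R"
    by (simp add: ideal_ring_of_type_iff)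
  then have M: "module ?R ?M" and N: "LinearCombinations.submodule ?R I ?M"
    using I module_ideal_module[of UNIV] submodule_ideal_module[of UNIV I] by simp_all
  have M_simps: "carrier ?M = UNIV" "a \<odot>\<^bsub>?M\<^esub> y = a * y" for a y
    by (simp_all add: ideal_module_def)
  have "P = {a \<in> carrier ?R. a \<odot>\<^bsub>quot_module ?M I\<^esub> (I +>\<^bsub>?M\<^esub> x) = \<zero>\<^bsub>quot_module ?M I\<^esub>}"
    using x by (simp add: smult_quot[OF M N] zero_quot[OF M N] coset_eq_zero_iff[OF M N] M_simps)
  moreover have "I +>\<^bsub>?M\<^esub> x \<in> carrier (quot_module ?M I)"
    by (simp add: carrier_quot[OF M N] M_simps)
  ultimately show ?thesis
    unfolding Ass_def assoc_primes_def ring_of_type_algebra_simps(1)[where 'a = 'a]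
    by (intro CollectI conjI P bexI)
qed


section \<open>Counting exponent vectors\<close>

abbreviation lookup :: "('a \<Rightarrow>\<^sub>0 'b::zero) \<Rightarrow> 'a \<Rightarrow> 'b" where
  "lookup \<equiv> Poly_Mapping.lookup"

abbreviation keys :: "('a \<Rightarrow>\<^sub>0 'b::zero) \<Rightarrow> 'a set" where
  "keys \<equiv> Poly_Mapping.keys"

abbreviation unit_vec :: "'n \<Rightarrow> 'n \<Rightarrow>\<^sub>0 nat" where
  "unit_vec i \<equiv> Poly_Mapping.single i 1"

definition upset :: "('n \<Rightarrow>\<^sub>0 nat) set \<Rightarrow> bool" where
  "upset U \<longleftrightarrow> (\<forall>t\<in>U. \<forall>s. s + t \<in> U)"

definition vanishes_on :: "'n set \<Rightarrow> ('n \<Rightarrow>\<^sub>0 nat) \<Rightarrow> bool" where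
  "vanishes_on S u \<longleftrightarrow> (\<forall>i\<in>S. lookup u i = 0)"

text \<open>The exponents obtained from \<open>U\<close> when the variables outside \<open>S\<close> become units.\<close>

definition sat :: "'n set \<Rightarrow> ('n \<Rightarrow>\<^sub>0 nat) set \<Rightarrow> ('n \<Rightarrow>\<^sub>0 nat) set" where
  "sat S U = {t. \<exists>u. vanishes_on S u \<and> t + u \<in> U}"

definition minimal_elems :: "('n \<Rightarrow>\<^sub>0 nat) set \<Rightarrow> ('n \<Rightarrow>\<^sub>0 nat) set" where
  "minimal_elems W = {a \<in> W. \<forall>i. lookup a i > 0 \<longrightarrow> a - unit_vec i \<notin> W}"

lemma vanishes_on_add [simp]:
  "vanishes_on S (u + v) \<longleftrightarrow> vanishes_on S u \<and> vanishes_on S v"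
  by (auto simp: vanishes_on_def lookup_add)

lemma vanishes_on_zero [simp]: "vanishes_on S 0"
  by (simp add: vanishes_on_def)

lemma vanishes_on_single: "i \<notin> S \<Longrightarrow> vanishes_on S (Poly_Mapping.single i c)"
  by (auto simp: vanishes_on_def lookup_single when_def)

lemma vanishes_on_UNIV [simp]: "vanishes_on UNIV u \<longleftrightarrow> u = 0"
  by (auto simp: vanishes_on_def intro: poly_mapping_eqI)

lemma vanishes_on_sum: "(\<And>x. x \<in> A \<Longrightarrow> vanishes_on S (f x)) \<Longrightarrow> vanishes_on S (sum f A)"
  by (induction A rule: infinite_finite_induct) auto

lemma upset_sat: "upset U \<Longrightarrow> upset (sat S U)"
  unfolding upset_def sat_def by (auto simp: add.assoc)

lemma sat_add_iff: "vanishes_on S u \<Longrightarrow> upset U \<Longrightarrow> t + u \<in> sat S U \<longleftrightarrow> t \<in> sat S U"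
proof -
  assume u: "vanishes_on S u" and U: "upset U"
  have "t \<in> sat S U" if "t + u \<in> sat S U"
    using that u
    unfolding sat_def mem_Collect_eq add.assoc by (metis vanishes_on_add)
  moreover have "t + u \<in> sat S U" if "t \<in> sat S U"
    using that upset_sat[OF U, of S] by (simp add: upset_def add.commute)
  ultimately show ?thesis by blast
qed

lemma sat_UNIV [simp]: "sat UNIV U = U"
  by (simp add: sat_def)

lemma sat_empty: "upset U \<Longrightarrow> U \<noteq> {} \<Longrightarrow> sat {} U = UNIV"
  unfolding upset_def sat_def vanishes_on_def by auto

lemma upset_le:
  assumes "upset U" "a \<in> U" "\<And>i. lookup a i \<le> lookup b i"
  shows "b \<in> U"
proof -
  have "b = (b - a) + a"
    by (rule poly_mapping_eqI) (simp add: lookup_add lookup_minus assms(3))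
  then show ?thesis
    using assms(1,2) unfolding upset_def by metis
qed

lemma unit_vec_decomp:
  "lookup t i > 0 \<Longrightarrow> t = unit_vec i + (t - unit_vec i)"
  by (rule poly_mapping_eqI) (auto simp: lookup_add lookup_minus lookup_single when_def)

lemma upset_INT: "(\<And>S. S \<in> F \<Longrightarrow> upset (W S)) \<Longrightarrow> upset (\<Inter>S\<in>F. W S)"
  by (auto simp: upset_def)

lemma minimal_elems_cover:
  assumes "t \<in> W" "t \<notin> minimal_elems W"
  obtains i s where "s \<in> W" "t = unit_vec i + s"
proof -
  obtain i where i: "lookup t i > 0" "t - unit_vec i \<in> W"
    using assms by (auto simp: minimal_elems_def)
  show ?thesis
    using that[OF i(2) unit_vec_decomp[OF i(1)]] .
qed

text \<open>The point \<open>a\<close> lies on the boundary of \<open>W\<close> in direction \<open>i\<close>; the coordinate hyperplane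
  \<open>a\<^sub>i = 0\<close> counts as boundary, so that minimality in \<open>W\<close> implies tightness in every direction.\<close>

definition tight :: "('n \<Rightarrow>\<^sub>0 nat) set \<Rightarrow> 'n \<Rightarrow> ('n \<Rightarrow>\<^sub>0 nat) \<Rightarrow> bool" where
  "tight W i a \<longleftrightarrow> a \<in> W \<and> (lookup a i > 0 \<longrightarrow> a - unit_vec i \<notin> W)"

text \<open>A tight coordinate is the least one compatible with the others, because \<open>W\<close> is an up-set.\<close>

lemma tight_le:
  assumes W: "upset W" and a: "a \<in> W" and b: "tight W i b"
    and le: "\<And>k. k \<noteq> i \<Longrightarrow> lookup a k \<le> lookup b k"
  shows "lookup b i \<le> lookup a i"
proof (rule ccontr)
  assume "\<not> ?thesis"
  then have less: "lookup a i < lookup b i" by simp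
  have "b - unit_vec i \<in> W"
    by (rule upset_le[OF W a]) (use le less in \<open>auto simp: lookup_minus lookup_single when_def\<close>)
  then show False
    using b less by (simp add: tight_def)
qed

lemma card_determined_by_coordinates:
  fixes M :: "('n::finite \<Rightarrow>\<^sub>0 nat) set"
  assumes bound: "\<And>a k. a \<in> M \<Longrightarrow> lookup a k \<le> B"
    and det: "\<And>a b. a \<in> M \<Longrightarrow> b \<in> M \<Longrightarrow>
      \<forall>k\<in>K. lookup a k = lookup b k \<Longrightarrow> a = b"
  shows "finite M" and "card M \<le> (B + 1) ^ card K"
proof -
  let ?f = "\<lambda>a. restrict (lookup a) K"
  let ?B = "K \<rightarrow>\<^sub>E {..B}"
  have inj: "inj_on ?f M"
  proof (rule inj_onI)
    fix a b assume "a \<in> M" "b \<in> M" "?f a = ?f b"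
    then show "a = b"
      by (intro det) (auto dest: fun_cong simp: restrict_def split: if_splits)
  qed
  have sub: "?f ` M \<subseteq> ?B" using bound by auto
  have fin: "finite ?B" by (simp add: finite_PiE)
  then show "finite M"
    using inj sub by (meson finite_imageD finite_subset)
  have "card M \<le> card ?B"
    by (rule card_inj_on_le[OF inj sub fin])
  then show "card M \<le> (B + 1) ^ card K"
    by (simp add: card_PiE)
qed

text \<open>The two tightness conditions determine the coordinates \<open>i\<close> and \<open>j\<close> one after the other from the
  remaining ones. Determining \<open>a\<^sub>i\<close> first is possible although \<open>a\<^sub>j\<close> is still unknown: \<open>j \<notin> S\<close>, so
  \<open>sat S U\<close> does not see the coordinate \<open>j\<close>.\<close>

lemma card_doubly_tight:
  fixes U :: "('n::finite \<Rightarrow>\<^sub>0 nat) set" and S' :: "'n set" and B :: nat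
  assumes U: "upset U" and i: "i \<in> S" and j: "j \<notin> S"
  defines "M \<equiv> {a. (\<forall>k. lookup a k \<le> B) \<and> tight (sat S U) i a \<and> tight (sat S' U) j a}"
  shows "finite M" and "card M \<le> (B + 1) ^ (CARD('n) - 2)"
proof -
  have ij: "i \<noteq> j" using i j by blast
  have det: "a = b"
    if "a \<in> M" "b \<in> M" and
      eq: "\<And>k. k \<in> UNIV - {i, j} \<Longrightarrow> lookup a k = lookup b k" for a b
  proof -
    have le_i: "lookup b i \<le> lookup a i"
      if "a \<in> M" "b \<in> M" and
        eq: "\<And>k. k \<in> UNIV - {i, j} \<Longrightarrow> lookup a k = lookup b k" for a b
    proof -
      \<comment> \<open>Membership in \<open>sat S U\<close> ignores the coordinate \<open>j\<close>, so \<open>b\<close> may be raised there to dominate \<open>a\<close>.\<close>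
      let ?c = "Poly_Mapping.single j (lookup a j) :: 'n \<Rightarrow>\<^sub>0 nat"
      have c: "vanishes_on S ?c" by (rule vanishes_on_single[OF j])
      have c_tight: "tight (sat S U) i (b + ?c)"
      proof -
        have "b + ?c - unit_vec i = (b - unit_vec i) + ?c" if "lookup b i > 0"
          using that by (intro poly_mapping_eqI)
            (auto simp: lookup_add lookup_minus lookup_single when_def ij)
        then show ?thesis
          using \<open>b \<in> M\<close> ij sat_add_iff[OF c U]
          by (auto simp: M_def tight_def lookup_add lookup_single when_def)
      qed
      have aS: "a \<in> sat S U"
        using \<open>a \<in> M\<close> by (simp add: M_def tight_def)
      have "lookup a k \<le> lookup (b + ?c) k" if "k \<noteq> i" for k
        using that eq[of k] by (cases "k = j") (auto simp: lookup_add lookup_single)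
      then have "lookup (b + ?c) i \<le> lookup a i"
        by (rule tight_le[OF upset_sat[OF U] aS c_tight])
      then show ?thesis by (simp add: lookup_add)
    qed
    have eq_i: "lookup a i = lookup b i"
      using le_i[OF that] le_i[OF that(2,1) eq[symmetric]] by (rule antisym[rotated])
    have le_j: "lookup b j \<le> lookup a j"
      if "a \<in> M" "b \<in> M" and
        "\<And>k. k \<noteq> j \<Longrightarrow> lookup a k = lookup b k" for a b
    proof (rule tight_le[OF upset_sat[OF U]])
      show "a \<in> sat S' U" "tight (sat S' U) j b"
        using that(1,2) by (simp_all add: M_def tight_def)
    qed (use that(3) in simp)
    have eq': "lookup a k = lookup b k" if "k \<noteq> j" for k
      using that eq eq_i by (cases "k = i") auto
    have "lookup a j = lookup b j"
      using le_j[OF that(1,2) eq'] le_j[OF that(2,1) eq'[symmetric]] by (rule antisym[rotated])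
    then show "a = b"
      using eq' by (metis poly_mapping_eqI)
  qed
  have bound: "lookup a k \<le> B" if "a \<in> M" for a k
    using that by (simp add: M_def)
  have "card (UNIV - {i, j}) = CARD('n) - 2"
    using ij by (simp add: card_Diff_subset)
  moreover have "finite M \<and> card M \<le> (B + 1) ^ card (UNIV - {i, j})"
    by (intro conjI card_determined_by_coordinates) (blast intro: bound det)+
  ultimately show "finite M" "card M \<le> (B + 1) ^ (CARD('n) - 2)"
    by simp_all
qed

text \<open>A nonzero minimal element fails some \<open>S \<in> F\<close> when a positive coordinate \<open>i\<close> is lowered, whence
  \<open>i \<in> S\<close>, and there is a \<open>j \<notin> S\<close>; so it is doubly tight for one of finitely many choices of
  \<open>(i, j, S, S')\<close>. The bound \<open>B\<close> on exponents outside the contracted ideals bounds its coordinates.\<close>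

lemma card_minimal_elems_sat:
  fixes U :: "('n::finite \<Rightarrow>\<^sub>0 nat) set" and F :: "'n set set"
  assumes U: "upset U" and F: "UNIV \<notin> F"
    and zero: "0 \<notin> (\<Inter>S\<in>F. sat S U)"
    and bound: "\<And>S i t. S \<in> F \<Longrightarrow> i \<in> S \<Longrightarrow> lookup t i \<ge> B \<Longrightarrow> t \<in> sat S U"
  shows "finite (minimal_elems (\<Inter>S\<in>F. sat S U))"
    and "card (minimal_elems (\<Inter>S\<in>F. sat S U)) \<le>
      card {(i :: 'n, j :: 'n, S :: 'n set, S' :: 'n set). i \<in> S \<and> j \<notin> S} * (B + 1) ^ (CARD('n) - 2)"
proof -
  let ?W = "\<Inter>S\<in>F. sat S U"
  let ?T = "{(i :: 'n, j :: 'n, S :: 'n set, S' :: 'n set). i \<in> S \<and> j \<notin> S}"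
  define M where "M = (\<lambda>(i, j, S, S'). {a. (\<forall>k. lookup a k \<le> B) \<and>
    tight (sat S U) i a \<and> tight (sat S' U) j a})"
  have M: "finite (M x)" "card (M x) \<le> (B + 1) ^ (CARD('n) - 2)" if "x \<in> ?T" for x
  proof -
    obtain i j S S' where x: "x = (i, j, S, S')" "i \<in> S" "j \<notin> S"
      using \<open>x \<in> ?T\<close> by auto
    show "finite (M x)" "card (M x) \<le> (B + 1) ^ (CARD('n) - 2)"
      using card_doubly_tight[OF U x(2,3), of B S'] by (simp_all add: M_def x(1))
  qed
  have fail: "\<exists>S\<in>F. i \<in> S \<and> tight (sat S U) i a"
    if a: "a \<in> minimal_elems ?W" "lookup a i > 0" for a i
  proof -
    obtain S where S: "S \<in> F" "a - unit_vec i \<notin> sat S U"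
      using a by (auto simp: minimal_elems_def)
    have aS: "a \<in> sat S U"
      using a S by (auto simp: minimal_elems_def)
    have "a = (a - unit_vec i) + unit_vec i"
      using unit_vec_decomp[OF a(2)] by (simp only: add.commute)
    then have "i \<in> S"
      using aS S(2) sat_add_iff[OF vanishes_on_single U] by metis
    then show ?thesis
      using aS S by (auto simp: tight_def)
  qed
  have cover: "minimal_elems ?W \<subseteq> (\<Union>x\<in>?T. M x)"
  proof
    fix a assume a: "a \<in> minimal_elems ?W"
    have le: "lookup a k \<le> B" for k
    proof (rule ccontr)
      assume "\<not> ?thesis"
      then have k: "lookup a k > B" by simp
      then obtain S where S: "S \<in> F" "k \<in> S" "tight (sat S U) k a"
        using fail[OF a, of k] by auto
      have "a - unit_vec k \<in> sat S U"
        by (rule bound[OF S(1,2)]) (use k in \<open>simp add: lookup_minus lookup_single\<close>)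
      then show False
        using S(3) k by (simp add: tight_def)
    qed
    have "a \<noteq> 0"
      using a zero by (auto simp: minimal_elems_def)
    then obtain i where "lookup a i > 0"
      using poly_mapping_eqI[of a 0] by auto
    then obtain S where S: "S \<in> F" "i \<in> S" "tight (sat S U) i a"
      using fail[OF a] by blast
    have "S \<noteq> UNIV"
      using S(1) F by blast
    then obtain j where j: "j \<notin> S"
      by blast
    obtain S' where S': "tight (sat S' U) j a"
    proof (cases "lookup a j > 0")
      case True
      then show ?thesis using fail[OF a] that by blast
    next
      case False
      \<comment> \<open>For \<open>a\<^sub>j = 0\<close> one takes \<open>S' = {}\<close>, for which \<open>sat S' U\<close> is everything.\<close>
      have "U \<noteq> {}"
        using S(3) by (auto simp: tight_def sat_def)
      then show ?thesis
        using False that[of "{}"] by (simp add: tight_def sat_empty[OF U])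
    qed
    have "a \<in> M (i, j, S, S')"
      using le S S' by (simp add: M_def)
    then show "a \<in> (\<Union>x\<in>?T. M x)"
      using S(2) j by blast
  qed
  have fin: "finite (\<Union>x\<in>?T. M x)"
    using M(1) by (intro finite_UN_I) auto
  show "finite (minimal_elems ?W)"
    by (rule finite_subset[OF cover fin])
  have "card (minimal_elems ?W) \<le> card (\<Union>x\<in>?T. M x)"
    by (rule card_mono[OF fin cover])
  also have "\<dots> \<le> (\<Sum>x\<in>?T. card (M x))"
    by (rule card_UN_le) simp
  also have "\<dots> \<le> (\<Sum>x\<in>?T. (B + 1) ^ (CARD('n) - 2))"
    using M(2) by (intro sum_mono)
  finally show "card (minimal_elems ?W) \<le> card ?T * (B + 1) ^ (CARD('n) - 2)"
    by simp
qed


section \<open>Monomial ideals as sets of exponents\<close>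

definition supported :: "('n \<Rightarrow>\<^sub>0 nat) set \<Rightarrow> (('n \<Rightarrow>\<^sub>0 nat) \<Rightarrow>\<^sub>0 'k::zero) set" where
  "supported U = {f. keys f \<subseteq> U}"

definition sumset :: "('n \<Rightarrow>\<^sub>0 nat) set \<Rightarrow> ('n \<Rightarrow>\<^sub>0 nat) set \<Rightarrow> ('n \<Rightarrow>\<^sub>0 nat) set" where
  "sumset U V = {u + v | u v. u \<in> U \<and> v \<in> V}"

lemma poly_mapping_sum_terms: "f = (\<Sum>t\<in>keys f. Poly_Mapping.single t (lookup f t))"
  by (rule poly_mapping_eqI)
    (auto simp: lookup_sum lookup_single when_def sum.delta in_keys_iff)

text \<open>Every polynomial is the sum of its terms, so a linear statement has to be checked on terms only.\<close>

lemma supported_subsetI: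
  fixes Z :: "(('n \<Rightarrow>\<^sub>0 nat) \<Rightarrow>\<^sub>0 'k::comm_monoid_add) set"
  assumes "0 \<in> Z" "\<And>f g. f \<in> Z \<Longrightarrow> g \<in> Z \<Longrightarrow> f + g \<in> Z"
    and "\<And>t c. t \<in> U \<Longrightarrow> Poly_Mapping.single t c \<in> Z"
  shows "supported U \<subseteq> Z"
proof
  fix f :: "('n \<Rightarrow>\<^sub>0 nat) \<Rightarrow>\<^sub>0 'k" assume f: "f \<in> supported U"
  have "(\<Sum>t\<in>A. Poly_Mapping.single t (lookup f t)) \<in> Z" if "finite A" "A \<subseteq> U" for A
    using that assms by (induction A rule: finite_induct) auto
  then show "f \<in> Z"
    using f poly_mapping_sum_terms[of f] unfolding supported_def by (metis (lifting) finite_keys mem_Collect_eq)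
qed

lemma single_mem_supported [simp]: "Poly_Mapping.single t c \<in> supported U \<longleftrightarrow> c = 0 \<or> t \<in> U"
  by (auto simp: supported_def)

lemma supported_subset_iff [simp]:
  "(supported U :: (('n \<Rightarrow>\<^sub>0 nat) \<Rightarrow>\<^sub>0 'k::zero_neq_one) set) \<subseteq> supported V \<longleftrightarrow> U \<subseteq> V"
proof
  assume sub: "(supported U :: (('n \<Rightarrow>\<^sub>0 nat) \<Rightarrow>\<^sub>0 'k) set) \<subseteq> supported V"
  show "U \<subseteq> V"
  proof
    fix t assume "t \<in> U"
    then have "Poly_Mapping.single t (1::'k) \<in> supported U" by simp
    then have "Poly_Mapping.single t (1::'k) \<in> supported V" using sub by blast
    then show "t \<in> V" by simp
  qed
qed (auto simp: supported_def)

lemma supported_mult: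
  "f \<in> supported U \<Longrightarrow> g \<in> supported V \<Longrightarrow> f * g \<in> supported (sumset U V)"
  using keys_mult[of f g] by (fastforce simp: supported_def sumset_def)

lemma supported_add: "f \<in> supported U \<Longrightarrow> g \<in> supported U \<Longrightarrow> f + g \<in> supported U"
  using Poly_Mapping.keys_add[of f g] by (auto simp: supported_def)

lemma sumset_UNIV_subset: "upset U \<Longrightarrow> sumset UNIV U \<subseteq> U"
  by (auto simp: sumset_def upset_def)

lemma upset_sumset: "upset U \<Longrightarrow> upset (sumset U V)"
  unfolding upset_def sumset_def by (auto simp: add.assoc[symmetric]) blast

lemma ideal_supported:
  assumes "upset U"
  shows "ideal (supported U :: ('n::{finite, linorder}, 'k::field) mpoly set) polyR"
proof -
  have "r * a \<in> supported U" if "a \<in> supported U" for r a :: "('n, 'k) mpoly"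
  proof -
    have "r \<in> supported UNIV" by (simp add: supported_def)
    then have "r * a \<in> supported (sumset UNIV U)" using that by (rule supported_mult)
    then show ?thesis
      using sumset_UNIV_subset[OF assms] by (auto simp: supported_def)
  qed
  then show ?thesis
    unfolding ideal_ring_of_type_iff by (auto simp: supported_add) (simp add: supported_def)
qed

lemma Idl_monomials:
  fixes T :: "('n::{finite, linorder} \<Rightarrow>\<^sub>0 nat) set"
  shows "Idl\<^bsub>polyR\<^esub> (monomial ` T) = (supported (sumset UNIV T) :: ('n, 'k::field) mpoly set)"
    and "upset (sumset UNIV T)"
proof -
  interpret R: cring "polyR :: ('n, 'k) mpoly ring"
    by (rule cring_from_type_algebra)
  show up: "upset (sumset UNIV T)"
    by (rule upset_sumset) (simp add: upset_def)
  let ?J = "Idl\<^bsub>polyR\<^esub> (monomial ` T) :: ('n, 'k) mpoly set"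
  have J: "ideal ?J polyR"
    by (rule R.genideal_ideal) simp
  show "?J = supported (sumset UNIV T)"
  proof
    have "(monomial t :: ('n, 'k) mpoly) \<in> supported (sumset UNIV T)" if "t \<in> T" for t
      using that unfolding monomial_def sumset_def by simp (metis add_0)
    then show "?J \<subseteq> supported (sumset UNIV T)"
      by (intro R.genideal_minimal ideal_supported up) auto
    show "supported (sumset UNIV T) \<subseteq> ?J"
    proof (rule supported_subsetI)
      fix t and c :: 'k assume "t \<in> sumset UNIV T"
      then obtain s v where "t = s + v" "v \<in> T" by (auto simp: sumset_def)
      then have "Poly_Mapping.single t c = Poly_Mapping.single s c * monomial v"
        by (simp add: monomial_def mult_single)
      moreover have "monomial v \<in> ?J"
        using R.genideal_self[of "monomial ` T"] \<open>v \<in> T\<close> by auto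
      ultimately show "Poly_Mapping.single t c \<in> ?J"
        using J by (simp add: ideal_ring_of_type_iff)
    qed (use J in \<open>auto simp: ideal_ring_of_type_iff\<close>)
  qed
qed

lemma ideal_prod_supported:
  fixes U V :: "('n::{finite, linorder} \<Rightarrow>\<^sub>0 nat) set"
  assumes "upset U" "upset V"
  shows "ideal_prod polyR (supported U) (supported V)
    = (supported (sumset U V) :: ('n, 'k::field) mpoly set)"
proof
  interpret R: cring "polyR :: ('n, 'k) mpoly ring"
    by (rule cring_from_type_algebra)
  show "ideal_prod polyR (supported U) (supported V)
    \<subseteq> (supported (sumset U V) :: ('n, 'k) mpoly set)"
  proof
    fix f :: "('n, 'k) mpoly"
    assume "f \<in> ideal_prod polyR (supported U) (supported V)"
    then show "f \<in> supported (sumset U V)"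
      by induction (auto intro: supported_mult supported_add)
  qed
  have J: "ideal (ideal_prod polyR (supported U) (supported V) :: ('n, 'k) mpoly set) polyR"
    by (intro R.ideal_prod_is_ideal ideal_supported assms)
  show "(supported (sumset U V) :: ('n, 'k) mpoly set)
    \<subseteq> ideal_prod polyR (supported U) (supported V)"
  proof (rule supported_subsetI)
    fix t and c :: 'k assume "t \<in> sumset U V"
    then obtain u v where uv: "t = u + v" "u \<in> U" "v \<in> V" by (auto simp: sumset_def)
    have "Poly_Mapping.single u c \<otimes>\<^bsub>polyR\<^esub> Poly_Mapping.single v 1
        \<in> ideal_prod polyR (supported U) (supported V)"
      by (rule ideal_prod.prod) (use uv in auto)
    then show "Poly_Mapping.single t c \<in> ideal_prod polyR (supported U) (supported V)"
      using uv by (simp add: mult_single)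
  qed (use J in \<open>auto simp: ideal_ring_of_type_iff\<close>)
qed

fun exponent_power :: "('n \<Rightarrow>\<^sub>0 nat) set \<Rightarrow> nat \<Rightarrow> ('n \<Rightarrow>\<^sub>0 nat) set" where
  "exponent_power U 0 = UNIV"
| "exponent_power U (Suc n) = sumset (exponent_power U n) U"

lemma upset_exponent_power: "upset (exponent_power U n)"
  by (induction n) (auto simp: upset_sumset, simp add: upset_def)

lemma ideal_power_supported:
  fixes U :: "('n::{finite, linorder} \<Rightarrow>\<^sub>0 nat) set"
  assumes U: "upset U"
  shows "ideal_power polyR (supported U) n
    = (supported (exponent_power U n) :: ('n, 'k::field) mpoly set)"
proof (induction n)
  case 0
  then show ?case
    by (simp add: ideal_power_def nat_pow_def ideals_set_def supported_def)
next
  case (Suc n)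
  have "ideal_power polyR (supported U) (Suc n)
      = ideal_prod polyR (ideal_power polyR (supported U) n) (supported U :: ('n, 'k) mpoly set)"
    by (simp add: ideal_power_def nat_pow_def ideals_set_def)
  then show ?case
    by (simp add: Suc ideal_prod_supported upset_exponent_power U)
qed

lemma exponent_power_subset:
  assumes "upset U" "n \<ge> 1"
  shows "exponent_power U n \<subseteq> U"
  using assms(2)
proof (cases n)
  case (Suc m)
  then show ?thesis
    using assms(1) by (auto simp: sumset_def upset_def)
qed simp

lemma exponent_power_UNIV: "exponent_power UNIV n = UNIV"
proof (induction n)
  case (Suc n)
  have "t \<in> sumset UNIV UNIV" for t :: "'a \<Rightarrow>\<^sub>0 nat"
    unfolding sumset_def by (metis (mono_tags, lifting) UNIV_I add_0 mem_Collect_eq)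
  with Suc show ?case by auto
qed simp

lemma multiple_mem_exponent_power:
  assumes "t \<in> U"
  shows "\<exists>s\<in>exponent_power U n. \<forall>k. lookup s k = n * lookup t k"
proof (induction n)
  case 0
  then show ?case by (auto intro!: exI[of _ 0])
next
  case (Suc n)
  then obtain s where "s \<in> exponent_power U n"
    "\<forall>k. lookup s k = n * lookup t k" by blast
  moreover from this have "s + t \<in> exponent_power U (Suc n)"
    using assms by (auto simp: sumset_def)
  ultimately show ?case
    by (intro bexI[of _ "s + t"]) (auto simp: lookup_add)
qed

text \<open>Up to variables outside \<open>S\<close>, which are units after localization, \<open>x\<^sup>t\<close> is a power of \<open>x\<^sub>i\<close>; its
  \<open>n\<close>-th power therefore lies in the contraction of the \<open>n\<close>-th power of the ideal.\<close>

lemma mem_sat_exponent_power: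
  fixes t a :: "'n::finite \<Rightarrow>\<^sub>0 nat"
  assumes "t \<in> U" "vanishes_on (S - {i}) t"
    and "n * lookup t i \<le> lookup a i"
  shows "a \<in> sat S (exponent_power U n)"
proof -
  obtain s where s: "s \<in> exponent_power U n"
    "\<And>k. lookup s k = n * lookup t k"
    using multiple_mem_exponent_power[OF assms(1)] by blast
  let ?u = "s - Poly_Mapping.single i (lookup s i)"
  have "vanishes_on S ?u"
    using assms(2) s(2) by (auto simp: vanishes_on_def lookup_minus lookup_single when_def)
  moreover have "a + ?u \<in> exponent_power U n"
  proof (rule upset_le[OF upset_exponent_power s(1)])
    show "lookup s k \<le> lookup (a + ?u) k" for k
      using assms(3) s(2) by (auto simp: lookup_add lookup_minus lookup_single when_def)
  qed
  ultimately show ?thesis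
    by (auto simp: sat_def)
qed


section \<open>Monomial primes\<close>

definition coord_prime :: "'n set \<Rightarrow> (('n \<Rightarrow>\<^sub>0 nat) \<Rightarrow>\<^sub>0 'k::zero) set" where
  "coord_prime S = supported {t. \<not> vanishes_on S t}"

definition part :: "('a \<Rightarrow> bool) \<Rightarrow> ('a \<Rightarrow>\<^sub>0 'b::zero) \<Rightarrow> ('a \<Rightarrow>\<^sub>0 'b)" where
  "part Q = Poly_Mapping.mapp (\<lambda>t c. c when Q t)"

lemma lookup_part: "lookup (part Q f) t = (lookup f t when Q t)"
  by (auto simp: part_def lookup_mapp when_def in_keys_iff)

lemma keys_part [simp]: "keys (part Q f) = {t \<in> keys f. Q t}"
  by (auto simp: in_keys_iff lookup_part when_def split: if_splits)

lemma part_plus_part: "part Q f + part (\<lambda>t. \<not> Q t) f = f"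
  for f :: "'a \<Rightarrow>\<^sub>0 'b::monoid_add"
  by (rule poly_mapping_eqI) (auto simp: lookup_add lookup_part when_def)

text \<open>The forms of lowest weight of \<open>f\<close> and \<open>g\<close> multiply to a nonzero polynomial, whose terms cannot
  be cancelled by any other product of terms because those have larger weight.\<close>

lemma lowest_weight_keys_mult:
  fixes f g :: "('n::{finite, linorder}, 'k::field) mpoly" and w :: "_ \<Rightarrow> nat"
  assumes w: "\<And>u v. w (u + v) = w u + w v" and "f \<noteq> 0" "g \<noteq> 0"
  obtains u v where "u \<in> keys f" "v \<in> keys g" "\<And>u'. u' \<in> keys f \<Longrightarrow> w u \<le> w u'"
    "\<And>v'. v' \<in> keys g \<Longrightarrow> w v \<le> w v'" "u + v \<in> keys (f * g)"
proof -
  have low: "\<exists>u\<in>keys h. \<forall>u'\<in>keys h. w u \<le> w u'" if "h \<noteq> 0" for h :: "('n, 'k) mpoly"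
    using that ex_has_least_nat[of "\<lambda>u. u \<in> keys h" _ w] by (metis all_not_in_conv keys_eq_empty)
  obtain a where a: "a \<in> keys f" "\<And>u. u \<in> keys f \<Longrightarrow> w a \<le> w u"
    using low[OF \<open>f \<noteq> 0\<close>] by blast
  obtain b where b: "b \<in> keys g" "\<And>v. v \<in> keys g \<Longrightarrow> w b \<le> w v"
    using low[OF \<open>g \<noteq> 0\<close>] by blast
  define f0 f1 where "f0 = part (\<lambda>u. w u = w a) f" and "f1 = part (\<lambda>u. w u \<noteq> w a) f"
  define g0 g1 where "g0 = part (\<lambda>v. w v = w b) g" and "g1 = part (\<lambda>v. w v \<noteq> w b) g"
  have f: "f = f0 + f1" and g: "g = g0 + g1"
    unfolding f0_def f1_def g0_def g1_def by (simp_all add: part_plus_part)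
  have f1: "w u > w a" if "u \<in> keys f1" for u
    using that a(2)[of u] by (auto simp: f1_def)
  have g1: "w v > w b" if "v \<in> keys g1" for v
    using that b(2)[of v] by (auto simp: g1_def)
  have "a \<in> keys f0" "b \<in> keys g0"
    using a b by (auto simp: f0_def g0_def)
  then have "f0 \<noteq> 0" "g0 \<noteq> 0" by auto
  then have "f0 * g0 \<noteq> 0" by simp
  then obtain t where t: "t \<in> keys (f0 * g0)"
    by (metis all_not_in_conv keys_eq_empty)
  then obtain u v where uv: "t = u + v" "u \<in> keys f0" "v \<in> keys g0"
    using keys_mult[of f0 g0] by auto
  have wt: "w t = w a + w b"
    using uv by (simp add: w f0_def g0_def)
  have "t \<notin> keys (f1 * g)"
    using keys_mult[of f1 g] f1 b(2) wt by (fastforce simp: w)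
  moreover have "t \<notin> keys (f0 * g1)"
    using keys_mult[of f0 g1] g1 wt by (fastforce simp: w f0_def)
  moreover have "f * g = f0 * g0 + f0 * g1 + f1 * g"
    unfolding f by (subst (2) g) (simp add: algebra_simps g)
  ultimately have "t \<in> keys (f * g)"
    using t by (simp add: in_keys_iff lookup_add)
  moreover have "w u = w a" "u \<in> keys f" "w v = w b" "v \<in> keys g"
    using uv by (auto simp: f0_def g0_def)
  ultimately show ?thesis
    using that[of u v] a(2) b(2) uv(1) by simp
qed

text \<open>Weighting exponents by their total degree in the coordinates of \<open>S\<close>, the weight-zero exponents
  are those vanishing on \<open>S\<close>. This yields both that \<open>(x\<^sub>i : i \<in> S)\<close> is prime and that
  denominators outside it can be replaced by monomials.\<close>

lemma keys_mult_vanishing: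
  fixes f g :: "('n::{finite, linorder}, 'k::field) mpoly"
  assumes f: "f \<notin> coord_prime S" and g: "g \<noteq> 0"
  obtains u v where "u \<in> keys f" "vanishes_on S u" "v \<in> keys g" "u + v \<in> keys (f * g)"
    "\<And>v'. v' \<in> keys g \<Longrightarrow> vanishes_on S v' \<Longrightarrow> vanishes_on S v"
proof -
  define w :: "('n \<Rightarrow>\<^sub>0 nat) \<Rightarrow> nat" where "w = (\<lambda>t. \<Sum>i\<in>S. lookup t i)"
  have w_add: "w (u + v) = w u + w v" for u v
    by (simp add: w_def lookup_add sum.distrib)
  have w_zero: "w t = 0 \<longleftrightarrow> vanishes_on S t" for t
    by (simp add: w_def vanishes_on_def)
  obtain s where s: "s \<in> keys f" "vanishes_on S s"
    using f by (auto simp: coord_prime_def supported_def)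
  then have "f \<noteq> 0" by auto
  obtain u v where uv: "u \<in> keys f" "v \<in> keys g" "\<And>u'. u' \<in> keys f \<Longrightarrow> w u \<le> w u'"
    "\<And>v'. v' \<in> keys g \<Longrightarrow> w v \<le> w v'" "u + v \<in> keys (f * g)"
    using lowest_weight_keys_mult[OF w_add \<open>f \<noteq> 0\<close> g] by blast
  show ?thesis
  proof (rule that[OF uv(1) _ uv(2,5)])
    show "vanishes_on S u"
      using uv(3)[OF s(1)] s(2) w_zero by (metis le_zero_eq)
    show "vanishes_on S v" if "v' \<in> keys g" "vanishes_on S v'" for v'
      using uv(4)[OF that(1)] that(2) w_zero by (metis le_zero_eq)
  qed
qed

lemma upset_not_vanishes_on: "upset {t. \<not> vanishes_on S t}"
  by (simp add: upset_def)

lemma primeideal_coord_prime: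
  "primeideal (coord_prime S :: ('n::{finite, linorder}, 'k::field) mpoly set) polyR"
  unfolding primeideal_ring_of_type_iff
proof (intro conjI allI impI)
  show "ideal (coord_prime S :: ('n, 'k) mpoly set) polyR"
    unfolding coord_prime_def by (intro ideal_supported upset_not_vanishes_on)
  show "(1 :: ('n, 'k) mpoly) \<notin> coord_prime S"
    by (simp add: coord_prime_def supported_def)
  fix f g :: "('n, 'k) mpoly"
  assume fg: "f * g \<in> coord_prime S"
  show "f \<in> coord_prime S \<or> g \<in> coord_prime S"
  proof (rule ccontr)
    assume "\<not> ?thesis"
    then have f: "f \<notin> coord_prime S" and g: "g \<notin> coord_prime S" by auto
    obtain v' where v': "v' \<in> keys g" "vanishes_on S v'"
      using g by (auto simp: coord_prime_def supported_def)
    then have "g \<noteq> 0" by auto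
    then obtain u v where "vanishes_on S u" "u + v \<in> keys (f * g)" "vanishes_on S v"
      using keys_mult_vanishing[OF f] v' by metis
    then show False
      using fg by (auto simp: coord_prime_def supported_def)
  qed
qed

lemma coord_prime_mono: "S \<subseteq> S' \<Longrightarrow> coord_prime S \<subseteq> coord_prime S'"
  unfolding coord_prime_def supported_def vanishes_on_def by blast

lemma var_mem_coord_prime_iff [simp]:
  "(var i :: ('n::{finite, linorder}, 'k::field) mpoly) \<in> coord_prime S \<longleftrightarrow> i \<in> S"
  by (auto simp: var_def monomial_def coord_prime_def vanishes_on_def lookup_single when_def)

lemma coord_prime_inject:
  "(coord_prime S :: ('n::{finite, linorder}, 'k::field) mpoly set) = coord_prime S' \<longleftrightarrow> S = S'"
proof
  assume "(coord_prime S :: ('n, 'k) mpoly set) = coord_prime S'"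
  then have "i \<in> S \<longleftrightarrow> i \<in> S'" for i
    using var_mem_coord_prime_iff[where 'k = 'k] by metis
  then show "S = S'" by blast
qed simp

text \<open>If \<open>s f\<close> has all its exponents in \<open>U\<close> and \<open>s\<close> lies outside the prime, remove from \<open>f\<close> its terms
  with exponents in \<open>sat S U\<close>. Were the rest \<open>f2\<close> nonzero, \<open>s f2\<close> would contain an exponent \<open>u + v\<close>
  with \<open>u\<close> vanishing on \<open>S\<close> and \<open>v\<close> an exponent of \<open>f2\<close>, and \<open>u + v \<in> sat S U\<close> gives \<open>v \<in> sat S U\<close>.\<close>

lemma localize_contract_supported:
  fixes U :: "('n::{finite, linorder} \<Rightarrow>\<^sub>0 nat) set"
  assumes U: "upset U"
  shows "localize_contract (coord_prime S) (supported U)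
    = (supported (sat S U) :: ('n, 'k::field) mpoly set)"
  unfolding localize_contract_eq[OF primeideal_coord_prime ideal_supported[OF U]]
proof (intro subset_antisym subsetI)
  fix f :: "('n, 'k) mpoly"
  assume "f \<in> {f. \<exists>s. s \<notin> coord_prime S \<and> s * f \<in> supported U}"
  then obtain s where s: "s \<notin> coord_prime S" "s * f \<in> supported U" by blast
  define f1 f2 where "f1 = part (\<lambda>t. t \<in> sat S U) f" and "f2 = part (\<lambda>t. t \<notin> sat S U) f"
  have f: "f = f1 + f2" unfolding f1_def f2_def by (simp add: part_plus_part)
  have f1: "f1 \<in> supported (sat S U)"
    by (auto simp: f1_def supported_def)
  have U_sub: "U \<subseteq> sat S U"
    by (auto simp: sat_def intro!: exI[of _ 0])
  have sat_ideal: "ideal (supported (sat S U) :: ('n, 'k) mpoly set) polyR"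
    by (rule ideal_supported[OF upset_sat[OF U]])
  have "f2 = 0"
  proof (rule ccontr)
    assume "f2 \<noteq> 0"
    then obtain u v where uv: "vanishes_on S u" "v \<in> keys f2" "u + v \<in> keys (s * f2)"
      using keys_mult_vanishing[OF s(1)] by metis
    have "s * f \<in> supported (sat S U)"
      using s(2) U_sub by (auto simp: supported_def)
    moreover have "- s * f1 \<in> supported (sat S U)"
      using f1 sat_ideal unfolding ideal_ring_of_type_iff by blast
    ultimately have "s * f + - s * f1 \<in> supported (sat S U)"
      by (rule supported_add)
    also have "s * f + - s * f1 = s * f2"
      by (simp add: f algebra_simps)
    finally have "v + u \<in> sat S U"
      using uv(3) by (auto simp: supported_def add.commute)
    then show False
      using uv(1,2) sat_add_iff[OF _ U] by (auto simp: f2_def)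
  qed
  then show "f \<in> supported (sat S U)"
    using f f1 by simp
next
  fix f :: "('n, 'k) mpoly"
  assume f: "f \<in> supported (sat S U)"
  then have "\<forall>t\<in>keys f. \<exists>u. vanishes_on S u \<and> t + u \<in> U"
    by (auto simp: supported_def sat_def)
  then obtain u where u: "\<And>t. t \<in> keys f \<Longrightarrow> vanishes_on S (u t)" "\<And>t. t \<in> keys f \<Longrightarrow> t + u t \<in> U"
    by metis
  \<comment> \<open>A common denominator for all terms of \<open>f\<close>.\<close>
  define d where "d = (\<Sum>t\<in>keys f. u t)"
  have d: "d + t \<in> U" if "t \<in> keys f" for t
  proof -
    have "d + t = (\<Sum>t'\<in>keys f - {t}. u t') + (t + u t)"
      using that by (simp add: d_def sum.remove[of "keys f" t] algebra_simps)
    then show ?thesis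
      using u(2)[OF that] U by (simp add: upset_def)
  qed
  have "monomial d * f \<in> supported (sumset {d} (keys f))"
    by (rule supported_mult) (simp_all add: monomial_def, simp add: supported_def)
  moreover have "sumset {d} (keys f) \<subseteq> U"
    using d by (auto simp: sumset_def)
  ultimately have "monomial d * f \<in> supported U"
    by (auto simp: supported_def)
  moreover have "(monomial d :: ('n, 'k) mpoly) \<notin> coord_prime S"
    using u(1) by (simp add: monomial_def coord_prime_def d_def vanishes_on_sum)
  ultimately show "f \<in> {f. \<exists>s. s \<notin> coord_prime S \<and> s * f \<in> supported U}"
    by blast
qed

lemma var_mem_prime_if_monomial_mem:
  fixes P :: "('n::{finite, linorder}, 'k::field) mpoly set"
  assumes P: "primeideal P polyR" and t: "monomial t \<in> P"
  shows "\<exists>i. lookup t i > 0 \<and> var i \<in> P"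
  using t
proof (induction "\<Sum>i\<in>UNIV. lookup t i" arbitrary: t)
  case 0
  then have "t = 0" by (auto intro: poly_mapping_eqI)
  then show ?case
    using P 0 by (simp add: monomial_def primeideal_ring_of_type_iff)
next
  case (Suc n)
  then have "\<not> (\<forall>i. lookup t i = 0)" by (metis Zero_not_Suc sum.neutral)
  then obtain i where i: "lookup t i > 0" by auto
  let ?s = "t - unit_vec i"
  note dec = unit_vec_decomp[OF i]
  have "monomial t = var i * (monomial ?s :: ('n, 'k) mpoly)"
    by (subst dec) (simp add: monomial_def var_def mult_single)
  then have "var i \<in> P \<or> monomial ?s \<in> P"
    using P Suc.prems by (auto simp: primeideal_ring_of_type_iff)
  then show ?case
  proof
    assume s: "monomial ?s \<in> P"
    have "lookup t k = lookup (unit_vec i) k + lookup ?s k" for k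
      by (subst dec) (simp only: lookup_add)
    then have "(\<Sum>k\<in>UNIV. lookup t k)
        = (\<Sum>k\<in>UNIV. lookup (unit_vec i) k + lookup ?s k)"
      by (intro sum.cong refl)
    also have "\<dots>
        = (\<Sum>k\<in>UNIV. lookup (unit_vec i) k) + (\<Sum>k\<in>UNIV. lookup ?s k)"
      by (rule sum.distrib)
    also have "(\<Sum>k\<in>UNIV. lookup (unit_vec i) k) = 1"
      by (simp add: lookup_single when_def)
    finally have "n = (\<Sum>k\<in>UNIV. lookup ?s k)"
      using Suc.hyps(2) by simp
    then obtain k where "lookup ?s k > 0" "var k \<in> P"
      using Suc.hyps(1) s by blast
    then show ?thesis
      by (intro exI[of _ k]) (auto simp: lookup_minus)
  qed (use i in blast)
qed

text \<open>A prime that contains a monomial contains one of its variables, so the prime generated by the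
  variables of \<open>P\<close> still contains the monomial ideal; by minimality it is all of \<open>P\<close>.\<close>

lemma minimal_prime_over_monomial_ideal:
  fixes P :: "('n::{finite, linorder}, 'k::field) mpoly set"
  assumes "minimal_prime_over polyR (supported U) P"
  shows "P = coord_prime {i. var i \<in> P}"
proof -
  let ?S = "{i. var i \<in> P}"
  have P: "primeideal P polyR" and sub: "supported U \<subseteq> P"
    and min: "\<And>Q. primeideal Q polyR \<Longrightarrow> supported U \<subseteq> Q \<Longrightarrow> Q \<subseteq> P \<Longrightarrow> Q = P"
    using assms by (auto simp: minimal_prime_over_def)
  have PI: "ideal P polyR"
    using P by (simp add: primeideal_ring_of_type_iff)
  have "coord_prime ?S \<subseteq> P"
    unfolding coord_prime_def
  proof (rule supported_subsetI)
    fix t and c :: 'k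
    assume "t \<in> {t. \<not> vanishes_on ?S t}"
    then obtain i where i: "var i \<in> P" "lookup t i > 0"
      by (auto simp: vanishes_on_def)
    have "Poly_Mapping.single t c = Poly_Mapping.single (t - unit_vec i) c * var i"
      by (subst unit_vec_decomp[OF i(2)]) (simp add: var_def monomial_def mult_single add.commute)
    then show "Poly_Mapping.single t c \<in> P"
      using PI i(1) by (simp add: ideal_ring_of_type_iff)
  qed (use PI in \<open>auto simp: ideal_ring_of_type_iff\<close>)
  moreover have "supported U \<subseteq> (coord_prime ?S :: ('n, 'k) mpoly set)"
    unfolding coord_prime_def supported_subset_iff
  proof
    fix t assume "t \<in> U"
    then have "monomial t \<in> P"
      using sub by (auto simp: monomial_def)
    then show "t \<in> {t. \<not> vanishes_on ?S t}"
      using var_mem_prime_if_monomial_mem[OF P] by (auto simp: vanishes_on_def)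
  qed
  ultimately show ?thesis
    using min primeideal_coord_prime by metis
qed

text \<open>Otherwise the monomial ideal would be contained in the strictly smaller prime generated by the
  variables in \<open>S - {i}\<close>.\<close>

lemma minimal_coord_prime_pure_power:
  fixes U :: "('n::{finite, linorder} \<Rightarrow>\<^sub>0 nat) set"
  assumes "minimal_prime_over polyR (supported U) (coord_prime S :: ('n, 'k::field) mpoly set)"
    and i: "i \<in> S"
  shows "\<exists>t\<in>U. vanishes_on (S - {i}) t"
proof (rule ccontr)
  assume "\<not> ?thesis"
  then have "supported U \<subseteq> (coord_prime (S - {i}) :: ('n, 'k) mpoly set)"
    by (auto simp: coord_prime_def)
  then have "(coord_prime (S - {i}) :: ('n, 'k) mpoly set) = coord_prime S"
    using assms(1) primeideal_coord_prime coord_prime_mono[of "S - {i}" S]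
    unfolding minimal_prime_over_def by blast
  then show False
    using i by (auto simp: coord_prime_inject)
qed

text \<open>Among the cosets \<open>t + \<nat>\<^sup>S\<^sup>c\<close> disjoint from \<open>U\<close> one chooses first \<open>S\<close> of minimal size, then \<open>t\<close>
  such that no translate of the coset by an \<open>e\<^sub>i\<close> with \<open>i \<in> S\<close> is disjoint from \<open>U\<close>; a suitable
  translate \<open>t'\<close> of \<open>t\<close> within its coset then has annihilator \<open>(x\<^sub>i : i \<in> S)\<close> modulo \<open>U\<close>.\<close>

lemma exists_coset_with_coordinate_annihilator:
  fixes U :: "('n::finite \<Rightarrow>\<^sub>0 nat) set"
  assumes U: "upset U" and proper: "0 \<notin> U"
  obtains S t where "\<And>u. vanishes_on S u \<Longrightarrow> t + u \<notin> U" "\<And>i. i \<in> S \<Longrightarrow> t + unit_vec i \<in> U"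
proof -
  define avoid where "avoid = (\<lambda>(S :: 'n set) t. \<forall>u. vanishes_on S u \<longrightarrow> t + u \<notin> U)"
  have "\<exists>t. avoid UNIV t"
    using proper by (auto simp: avoid_def)
  then obtain S where S: "\<exists>t. avoid S t" and S_min: "\<And>S'. \<exists>t. avoid S' t \<Longrightarrow> card S \<le> card S'"
    using ex_has_least_nat[of "\<lambda>S. \<exists>t. avoid S t" UNIV card] by blast
  obtain t0 where t0: "avoid S t0" using S by blast
  have "\<exists>c u. vanishes_on S u \<and> t0 + Poly_Mapping.single i c + u \<in> U" if i: "i \<in> S" for i
  proof -
    have "\<not> avoid (S - {i}) t0"
      using S_min[of "S - {i}"] i by (metis card_Diff1_less finite not_le)
    then obtain v where v: "vanishes_on (S - {i}) v" "t0 + v \<in> U"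
      by (auto simp: avoid_def)
    let ?c = "lookup v i"
    have "vanishes_on S (v - Poly_Mapping.single i ?c)"
      using v(1) by (auto simp: vanishes_on_def lookup_minus lookup_single when_def)
    moreover have "Poly_Mapping.single i ?c + (v - Poly_Mapping.single i ?c) = v"
      by (rule poly_mapping_eqI) (auto simp: lookup_add lookup_minus lookup_single when_def)
    ultimately show ?thesis
      using v(2) by (metis add.assoc)
  qed
  then obtain c u where cu: "\<And>i. i \<in> S \<Longrightarrow> vanishes_on S (u i)"
    "\<And>i. i \<in> S \<Longrightarrow> t0 + Poly_Mapping.single i (c i) + u i \<in> U"
    by metis
  define above where "above = (\<lambda>t. avoid S t \<and> (\<forall>k. lookup t0 k \<le> lookup t k))"
  define w where "w = (\<lambda>t :: 'n \<Rightarrow>\<^sub>0 nat. \<Sum>i\<in>S. lookup t i)"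
  have bounded: "w t \<le> (\<Sum>i\<in>S. lookup t0 i + c i)" if t: "above t" for t
    unfolding w_def
  proof (rule sum_mono, rule ccontr)
    fix i assume i: "i \<in> S" and "\<not> lookup t i \<le> lookup t0 i + c i"
    then have "lookup (t0 + Poly_Mapping.single i (c i) + u i) k
        \<le> lookup (t + u i) k" for k
      using t by (auto simp: above_def lookup_add lookup_single when_def)
    then have "t + u i \<in> U"
      by (rule upset_le[OF U cu(2)[OF i]])
    then show False
      using t cu(1)[OF i] by (auto simp: above_def avoid_def)
  qed
  have "above t0" using t0 by (simp add: above_def)
  then obtain t where t: "above t" and t_max: "\<And>s. above s \<Longrightarrow> w s \<le> w t"
    using ex_has_greatest_nat[of above t0 w "(\<Sum>i\<in>S. lookup t0 i + c i) + 1"] bounded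
    by (metis less_Suc_eq_le Suc_eq_plus1)
  have "\<exists>v. vanishes_on S v \<and> t + unit_vec i + v \<in> U" if i: "i \<in> S" for i
  proof (rule ccontr)
    assume "\<not> ?thesis"
    then have "avoid S (t + unit_vec i)" by (auto simp: avoid_def)
    then have "above (t + unit_vec i)"
      using t by (auto simp: above_def lookup_add intro: order_trans)
    then have "w (t + unit_vec i) \<le> w t" by (rule t_max)
    moreover have "w (t + unit_vec i) = w t + 1"
      using i by (simp add: w_def lookup_add sum.distrib lookup_single when_def)
    ultimately show False by simp
  qed
  then obtain v where v: "\<And>i. i \<in> S \<Longrightarrow> vanishes_on S (v i)"
    "\<And>i. i \<in> S \<Longrightarrow> t + unit_vec i + v i \<in> U"
    by metis
  define d where "d = (\<Sum>i\<in>S. v i)"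
  have d: "vanishes_on S d"
    unfolding d_def by (rule vanishes_on_sum[OF v(1)])
  show ?thesis
  proof (rule that[of S "t + d"])
    show "t + d + u \<notin> U" if "vanishes_on S u" for u
      using t d that by (auto simp: above_def avoid_def add.assoc)
    show "t + d + unit_vec i \<in> U" if i: "i \<in> S" for i
    proof -
      have "t + d + unit_vec i = (\<Sum>k\<in>S - {i}. v k) + (t + unit_vec i + v i)"
        using i by (simp add: d_def sum.remove[of S i] algebra_simps)
      then show ?thesis
        using v(2)[OF i] U by (simp add: upset_def)
    qed
  qed
qed

lemma Ass_nonempty:
  fixes U :: "('n::{finite, linorder} \<Rightarrow>\<^sub>0 nat) set"
  assumes U: "upset U" and proper: "0 \<notin> U"
  shows "Ass polyR (supported U :: ('n, 'k::field) mpoly set) \<noteq> {}"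
proof -
  obtain S t where t: "\<And>u. vanishes_on S u \<Longrightarrow> t + u \<notin> U" "\<And>i. i \<in> S \<Longrightarrow> t + unit_vec i \<in> U"
    using exists_coset_with_coordinate_annihilator[OF U proper] by blast
  have "coord_prime S = {f :: ('n, 'k) mpoly. f * monomial t \<in> supported U}"
  proof (intro subset_antisym subsetI)
    fix f :: "('n, 'k) mpoly"
    assume "f \<in> coord_prime S"
    then have "f * monomial t \<in> supported (sumset {s. \<not> vanishes_on S s} {t})"
      unfolding coord_prime_def by (rule supported_mult) (simp add: monomial_def)
    moreover have "s + t \<in> U" if s: "\<not> vanishes_on S s" for s
    proof -
      obtain i where i: "i \<in> S" "lookup s i > 0"
        using s by (auto simp: vanishes_on_def)
      have "s + t = (s - unit_vec i) + (t + unit_vec i)"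
        by (subst unit_vec_decomp[OF i(2)]) (simp add: algebra_simps)
      then show ?thesis
        using t(2)[OF i(1)] U by (simp add: upset_def)
    qed
    ultimately show "f \<in> {f. f * monomial t \<in> supported U}"
      by (auto simp: supported_def sumset_def)
  next
    fix f :: "('n, 'k) mpoly"
    assume f: "f \<in> {f. f * monomial t \<in> supported U}"
    show "f \<in> coord_prime S"
    proof (rule ccontr)
      assume nf: "f \<notin> coord_prime S"
      have mt: "(monomial t :: ('n, 'k) mpoly) \<noteq> 0" "keys (monomial t :: ('n, 'k) mpoly) = {t}"
        by (auto simp: monomial_def simp flip: keys_eq_empty)
      obtain u where "vanishes_on S u" "u + t \<in> keys (f * monomial t)"
        using keys_mult_vanishing[OF nf mt(1)] mt(2) by (metis singletonD)
      then have "t + u \<in> U"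
        using f by (auto simp: supported_def add.commute)
      then show False
        using t(1) \<open>vanishes_on S u\<close> by blast
    qed
  qed
  then have "coord_prime S \<in> Ass polyR (supported U :: ('n, 'k) mpoly set)"
    by (intro AssI primeideal_coord_prime ideal_supported U)
  then show ?thesis by blast
qed


section \<open>Generators of a quotient of monomial ideals\<close>

text \<open>The classes of the monomials in \<open>G\<close> span the quotient modulo the irrelevant ideal: any other
  monomial of the ideal of \<open>W\<close> lies in the ideal of \<open>V\<close>, or is a variable times a monomial of the
  ideal of \<open>W\<close>, and then its class vanishes.\<close>

lemma \<mu>_quotient_le_card:
  fixes V W :: "('n::{finite, linorder} \<Rightarrow>\<^sub>0 nat) set"
  assumes W: "upset W" and V: "upset V" and VW: "V \<subseteq> W"
    and G: "finite G" "G \<subseteq> W"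
    and cover: "\<And>t. t \<in> W \<Longrightarrow> t \<notin> G \<Longrightarrow> t \<notin> V \<Longrightarrow> \<exists>i. \<exists>s\<in>W. t = unit_vec i + s"
  shows "\<mu> (quot_module (ideal_module polyR (supported W :: ('n, 'k::field) mpoly set)) (supported V))
    \<le> card G"
proof -
  let ?R = "polyR :: ('n, 'k) mpoly ring"
  let ?K = "ring_of_type_algebra :: 'k ring"
  let ?A = "supported W :: ('n, 'k) mpoly set" and ?B = "supported V :: ('n, 'k) mpoly set"
  define M0 where "M0 = ideal_module ?R ?A"
  define M1 where "M1 = quot_module M0 ?B"
  define N1 where "N1 = ideal_smult ?R irrelevant_ideal M1"
  define M2 where "M2 = quot_module M1 N1"
  define Q where "Q = restrict_scalars const M2"
  interpret R: cring ?R by (rule cring_from_type_algebra)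
  have A: "ideal ?A ?R" and B: "ideal ?B ?R"
    using W V by (simp_all add: ideal_supported)
  have m0: "module ?R M0" and s0: "LinearCombinations.submodule ?R ?B M0"
    unfolding M0_def using A B VW by (simp_all add: module_ideal_module submodule_ideal_module)
  have M0_simps: "carrier M0 = ?A" "f \<oplus>\<^bsub>M0\<^esub> g = f + g" "f \<odot>\<^bsub>M0\<^esub> g = f * g" for f g
    by (simp_all add: M0_def ideal_module_def)
  have m1: "module ?R M1"
    unfolding M1_def by (rule module_quot[OF m0 s0])
  interpret M1: module ?R M1 by (rule m1)
  define Y where "Y = {a \<odot>\<^bsub>M1\<^esub> x | a x. a \<in> irrelevant_ideal \<and> x \<in> carrier M1}"
  have Y: "Y \<subseteq> carrier M1"
    by (auto simp: Y_def)
  have N1_eq: "N1 = M1.span Y"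
    by (simp add: N1_def ideal_smult_def Y_def)
  have s1: "LinearCombinations.submodule ?R N1 M1"
    unfolding N1_eq by (rule M1.span_is_submodule[OF Y])
  have m2: "module ?R M2"
    unfolding M2_def by (rule module_quot[OF m1 s1])
  have const_hom: "const \<in> ring_hom ?K ?R"
    by (rule ring_hom_memI) (auto simp: const_def mult_single single_add)
  have "module ?K Q"
    unfolding Q_def by (rule module_restrict_scalars[OF m2 cring_from_type_algebra const_hom])
  then interpret Q: vectorspace ?K Q
    by (intro vectorspace.intro field_from_type_algebra)
  \<comment> \<open>The projection onto the \<open>k\<close>-vector space whose dimension is \<open>\<mu>\<close>.\<close>
  define p where "p = (\<lambda>f. N1 +>\<^bsub>M1\<^esub> (?B +>\<^bsub>M0\<^esub> f))"
  have q: "?B +>\<^bsub>M0\<^esub> f \<in> carrier M1" if "f \<in> ?A" for f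
    using that by (auto simp: M1_def carrier_quot[OF m0 s0] M0_simps)
  have carrier_Q: "carrier Q = p ` ?A"
    by (simp add: Q_def restrict_scalars_def M2_def carrier_quot[OF m1 s1] p_def image_image
        carrier_quot[OF m0 s0, folded M1_def] M0_simps)
  have p_add: "p (f + g) = p f \<oplus>\<^bsub>Q\<^esub> p g" if "f \<in> ?A" "g \<in> ?A" for f g
    using that q add_quot[OF m1 s1, of "?B +>\<^bsub>M0\<^esub> f" "?B +>\<^bsub>M0\<^esub> g"] add_quot[OF m0 s0, of f g]
    by (simp add: Q_def restrict_scalars_def M2_def p_def M1_def M0_simps)
  have p_const: "p (const c * f) = c \<odot>\<^bsub>Q\<^esub> p f" if "f \<in> ?A" for c f
    using that q smult_quot[OF m1 s1, of "const c" "?B +>\<^bsub>M0\<^esub> f"] smult_quot[OF m0 s0, of "const c" f]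
    by (simp add: Q_def restrict_scalars_def M2_def p_def M1_def M0_simps)
  have zero_Q: "\<zero>\<^bsub>Q\<^esub> = N1"
    by (simp add: Q_def restrict_scalars_def M2_def zero_quot[OF m1 s1])
  have p_V: "p f = \<zero>\<^bsub>Q\<^esub>" if "f \<in> ?B" for f
  proof -
    have "?B +>\<^bsub>M0\<^esub> f = \<zero>\<^bsub>M1\<^esub>"
      unfolding M1_def zero_quot[OF m0 s0] by (rule coset_eq_zero[OF m0 s0 that])
    moreover have "\<zero>\<^bsub>M1\<^esub> \<in> N1"
      using s1 by (rule LinearCombinations.submodule.zero_closed)
    ultimately show ?thesis
      unfolding p_def zero_Q using coset_eq_zero[OF m1 s1] by simp
  qed
  have p_irrelevant: "p (var i * f) = \<zero>\<^bsub>Q\<^esub>" if "f \<in> ?A" for i f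
  proof -
    have "(var i :: ('n, 'k) mpoly) \<in> irrelevant_ideal"
      unfolding irrelevant_ideal_def using R.genideal_self[of "Set.range var"] by auto
    then have "var i \<odot>\<^bsub>M1\<^esub> (?B +>\<^bsub>M0\<^esub> f) \<in> Y"
      using q[OF that] by (auto simp: Y_def)
    then have "var i \<odot>\<^bsub>M1\<^esub> (?B +>\<^bsub>M0\<^esub> f) \<in> N1"
      unfolding N1_eq using M1.in_own_span[OF Y] by blast
    moreover have "var i \<odot>\<^bsub>M1\<^esub> (?B +>\<^bsub>M0\<^esub> f) = ?B +>\<^bsub>M0\<^esub> (var i * f)"
      using that smult_quot[OF m0 s0, of "var i" f] by (simp add: M1_def M0_simps)
    ultimately show ?thesis
      unfolding p_def zero_Q using coset_eq_zero[OF m1 s1] by simp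
  qed
  let ?g = "\<lambda>t. p (monomial t)"
  have g_sub: "?g ` G \<subseteq> carrier Q"
    using G(2) by (auto simp: carrier_Q monomial_def)
  have span: "LinearCombinations.submodule ?K (Q.span (?g ` G)) Q"
    by (rule Q.span_is_submodule[OF g_sub])
  note span_closed = LinearCombinations.submodule.m_closed[OF span]
    LinearCombinations.submodule.zero_closed[OF span]
    LinearCombinations.submodule.smult_closed[OF span]
  have p_monomial: "p (monomial t) \<in> Q.span (?g ` G)" if t: "t \<in> W" for t
  proof -
    consider "t \<in> G" | "t \<in> V" | i s where "s \<in> W" "t = unit_vec i + s"
      using cover[OF t] by blast
    then show ?thesis
    proof cases
      case 1
      then show ?thesis using Q.in_own_span[OF g_sub] by blast
    next
      case 2
      then show ?thesis using span_closed p_V[of "monomial t"] by (simp add: monomial_def)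
    next
      case (3 i s)
      have "monomial t = var i * (monomial s :: ('n, 'k) mpoly)"
        using 3 by (simp add: monomial_def var_def mult_single)
      then show ?thesis
        using span_closed p_irrelevant[of "monomial s" i] 3 by (simp add: monomial_def)
    qed
  qed
  have "?A \<subseteq> {f \<in> ?A. p f \<in> Q.span (?g ` G)}"
  proof (rule supported_subsetI)
    have "0 \<in> ?A" "0 \<in> ?B" by (simp_all add: supported_def)
    then show "0 \<in> {f \<in> ?A. p f \<in> Q.span (?g ` G)}"
      using span_closed(2) p_V by simp
    show "f + g \<in> {f \<in> ?A. p f \<in> Q.span (?g ` G)}"
      if "f \<in> {f \<in> ?A. p f \<in> Q.span (?g ` G)}" "g \<in> {f \<in> ?A. p f \<in> Q.span (?g ` G)}" for f g
      using that span_closed(1) p_add supported_add by auto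
    show "Poly_Mapping.single t c \<in> {f \<in> ?A. p f \<in> Q.span (?g ` G)}" if t: "t \<in> W" for t c
    proof -
      have eq: "Poly_Mapping.single t c = const c * monomial t"
        by (simp add: const_def monomial_def mult_single)
      have "const c * monomial t \<in> ?A"
        using t by (simp flip: eq)
      moreover have "p (const c * monomial t) \<in> Q.span (?g ` G)"
        using t span_closed(3)[of c, OF _ p_monomial[OF t]]
        by (subst p_const) (simp_all add: monomial_def)
      ultimately show ?thesis by (simp add: eq)
    qed
  qed
  then have "carrier Q \<subseteq> Q.span (?g ` G)"
    by (auto simp: carrier_Q)
  then have gen: "Q.gen_set (?g ` G)"
    using Q.span_is_subset2[OF g_sub] by blast
  have "Q.dim \<le> card (?g ` G)"
    using G(1) by (intro Q.gen_ge_dim g_sub gen) simp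
  also have "\<dots> \<le> card G"
    by (rule card_image_le[OF G(1)])
  also have "Q.dim = \<mu> (quot_module (ideal_module ?R ?A) ?B)"
    by (simp add: \<mu>_def Q_def M2_def N1_def M1_def M0_def)
  finally show ?thesis .
qed

section \<open>Growth of the symbolic defect\<close>

lemma Ass_without_embedded_primes:
  fixes I :: "('n::{finite, linorder}, 'k::field) mpoly set"
  assumes "without_embedded_primes polyR I" and I: "I = supported U"
  shows "Ass polyR I = coord_prime ` {S. coord_prime S \<in> Ass polyR I}"
proof (intro subset_antisym subsetI)
  fix P assume P: "P \<in> Ass polyR I"
  then have eq: "P = coord_prime {i. var i \<in> P}"
    using assms by (intro minimal_prime_over_monomial_ideal[of U])
      (simp add: without_embedded_primes_def)
  then have "coord_prime {i. var i \<in> P} \<in> Ass polyR I"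
    using P by metis
  with eq show "P \<in> coord_prime ` {S. coord_prime S \<in> Ass polyR I}"
    by blast
qed auto

lemma symbolic_power_supported:
  fixes U :: "('n::{finite, linorder} \<Rightarrow>\<^sub>0 nat) set"
  defines "I \<equiv> (supported U :: ('n, 'k::field) mpoly set)"
  assumes U: "upset U" and wep: "without_embedded_primes polyR I"
  shows "symbolic_power I n
    = supported (\<Inter>S\<in>{S. coord_prime S \<in> Ass polyR I}. sat S (exponent_power U n))"
proof -
  let ?F = "{S. coord_prime S \<in> Ass polyR I}"
  note Ass_eq = Ass_without_embedded_primes[OF wep I_def[THEN meta_eq_to_obj_eq]]
  have "symbolic_power I n = (\<Inter>S\<in>?F. localize_contract (coord_prime S) (ideal_power polyR I n))"
    unfolding symbolic_power_def by (subst Ass_eq) simp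
  also have "\<dots> = (\<Inter>S\<in>?F. supported (sat S (exponent_power U n)))"
    by (simp add: I_def ideal_power_supported[OF U] localize_contract_supported[OF upset_exponent_power])
  also have "\<dots> = supported (\<Inter>S\<in>?F. sat S (exponent_power U n))"
    by (auto simp: supported_def)
  finally show ?thesis .
qed

theorem theorem1p1:
  fixes I :: "('n::{finite, linorder}, 'k::field) mpoly set"
  assumes "monomial_ideal I"
    and "without_embedded_primes polyR I"
  shows "(\<lambda>n. real (sdef I n)) \<in> O(\<lambda>n. real n powi (int CARD('n) - 2))"
proof -
  obtain T where T: "I = Idl\<^bsub>polyR\<^esub> (monomial ` T)"
    using assms(1) by (auto simp: monomial_ideal_def)
  define U where "U = sumset UNIV T"
  have U: "upset U" and I: "I = supported U"
    unfolding U_def T by (rule Idl_monomials)+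
  define F where "F = {S. (coord_prime S :: ('n, 'k) mpoly set) \<in> Ass polyR I}"
  define W where "W = (\<lambda>n. \<Inter>S\<in>F. sat S (exponent_power U n))"
  have min: "minimal_prime_over polyR I (coord_prime S)" if "S \<in> F" for S
    using that assms(2) by (auto simp: F_def without_embedded_primes_def)
  have sdef_eq: "sdef I n = \<mu> (quot_module
      (ideal_module polyR (supported (W n) :: ('n, 'k) mpoly set)) (supported (exponent_power U n)))" for n
    using symbolic_power_supported[OF U, where 'k = 'k] assms(2)
    by (simp add: sdef_def I W_def F_def ideal_power_supported[OF U])
  have upW: "upset (W n)" for n
    unfolding W_def by (intro upset_INT upset_sat upset_exponent_power)
  have sub: "exponent_power U n \<subseteq> W n" for n
    by (auto simp: W_def sat_def intro!: exI[of _ 0])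
  have trivial: "sdef I n = 0" if "W n = exponent_power U n" for n
  proof -
    have "sdef I n \<le> card ({} :: ('n \<Rightarrow>\<^sub>0 nat) set)"
      unfolding sdef_eq by (rule \<mu>_quotient_le_card[OF upW upset_exponent_power sub]) (use that in auto)
    then show ?thesis by simp
  qed
  show ?thesis
  proof (cases "0 \<in> U \<or> UNIV \<in> F")
    case True
    have "W n = exponent_power U n" for n
      using True
    proof
      assume "0 \<in> U"
      then have "U = UNIV"
        using U by (auto simp: upset_def)
      then have "exponent_power U n = UNIV" by (simp add: exponent_power_UNIV)
      then show ?thesis using sub[of n] by auto
    next
      assume m: "UNIV \<in> F"
      have "S = UNIV" if S: "S \<in> F" for S
      proof -
        have "coord_prime S \<subseteq> (coord_prime UNIV :: ('n, 'k) mpoly set)"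
          by (rule coord_prime_mono) simp
        then have "coord_prime S = (coord_prime UNIV :: ('n, 'k) mpoly set)"
          using min[OF m] min[OF S] unfolding minimal_prime_over_def by blast
        then show ?thesis by (simp add: coord_prime_inject)
      qed
      then have "F = {UNIV}" using m by blast
      then show ?thesis by (simp add: W_def)
    qed
    then show ?thesis using trivial by simp
  next
    case False
    have "Ass polyR I \<noteq> {}"
      using Ass_nonempty[OF U, where 'k = 'k] False I by blast
    then have "F \<noteq> {}"
      unfolding F_def using Ass_without_embedded_primes[OF assms(2) I] by (metis image_empty)
    then obtain S0 where S0: "S0 \<in> F" by blast
    have "\<exists>t\<in>U. vanishes_on (S - {i}) t" if "S \<in> F" "i \<in> S" for S i
      using minimal_coord_prime_pure_power[of U S, where 'k = 'k] min[OF that(1)] that(2) I by simp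
    then obtain e where e: "\<And>S i. S \<in> F \<Longrightarrow> i \<in> S \<Longrightarrow> e S i \<in> U"
      "\<And>S i. S \<in> F \<Longrightarrow> i \<in> S \<Longrightarrow> vanishes_on (S - {i}) (e S i)"
      by metis
    define D where "D = (\<Sum>S\<in>UNIV. \<Sum>i\<in>UNIV. lookup (e S i) i)"
    have D: "lookup (e S i) i \<le> D" for S i
    proof -
      have "lookup (e S i) i \<le> (\<Sum>i\<in>UNIV. lookup (e S i) i)"
        by (rule member_le_sum) auto
      also have "\<dots> \<le> D"
        unfolding D_def by (rule member_le_sum) auto
      finally show ?thesis .
    qed
    define C where "C = card {(i :: 'n, j :: 'n, S :: 'n set, S' :: 'n set). i \<in> S \<and> j \<notin> S}"
    define r where "r = CARD('n)"
    have le: "sdef I n \<le> C * (D * n + 1) ^ (r - 2)" if n: "n \<ge> 1" for n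
    proof -
      have zero: "0 \<notin> (\<Inter>S\<in>F. sat S (exponent_power U n))"
      proof
        assume "0 \<in> (\<Inter>S\<in>F. sat S (exponent_power U n))"
        then obtain u where "vanishes_on S0 u" "u \<in> exponent_power U n"
          using S0 by (auto simp: sat_def)
        moreover have "U \<subseteq> {t. \<not> vanishes_on S0 t}"
          using min[OF S0] unfolding I minimal_prime_over_def by (simp add: coord_prime_def)
        ultimately show False
          using exponent_power_subset[OF U n] by blast
      qed
      have bound: "t \<in> sat S (exponent_power U n)"
        if "S \<in> F" "i \<in> S" "D * n \<le> lookup t i" for S i t
      proof (rule mem_sat_exponent_power[OF e(1)[OF that(1,2)] e(2)[OF that(1,2)]])
        have "n * lookup (e S i) i \<le> n * D"
          using D by (intro mult_left_mono) auto
        also have "n * D \<le> lookup t i"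
          using that(3) by (simp only: mult.commute)
        finally show "n * lookup (e S i) i \<le> lookup t i" .
      qed
      have F: "UNIV \<notin> F" using False by blast
      have fin: "finite (minimal_elems (W n))"
        "card (minimal_elems (W n)) \<le> C * (D * n + 1) ^ (r - 2)"
        unfolding W_def C_def r_def
        by (rule card_minimal_elems_sat[OF upset_exponent_power F zero], erule (2) bound)+
      have "sdef I n \<le> card (minimal_elems (W n))"
        unfolding sdef_eq
      proof (rule \<mu>_quotient_le_card[OF upW upset_exponent_power sub])
        show "finite (minimal_elems (W n))" by (rule fin(1))
        show "minimal_elems (W n) \<subseteq> W n" by (auto simp: minimal_elems_def)
        show "\<exists>i. \<exists>s\<in>W n. t = unit_vec i + s" if "t \<in> W n" "t \<notin> minimal_elems (W n)" for t
          using minimal_elems_cover[OF that] by metis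
      qed
      also have "\<dots> \<le> C * (D * n + 1) ^ (r - 2)"
        by (rule fin(2))
      finally show ?thesis .
    qed
    \<comment> \<open>In one variable \<open>r - 2\<close> is truncated to \<open>0\<close>, but there the constant vanishes.\<close>
    have C0: "C = 0" if "r < 2"
    proof -
      have "r = 1"
        using that by (simp add: r_def) (metis One_nat_def less_2_cases_iff zero_less_card_finite less_irrefl)
      then obtain x :: 'n where "UNIV = {x}"
        unfolding r_def by (auto simp: card_1_singleton_iff)
      then have "i = j" for i j :: 'n by (metis UNIV_I singletonD)
      then have "{(i :: 'n, j :: 'n, S :: 'n set, S' :: 'n set). i \<in> S \<and> j \<notin> S} = {}" by auto metis
      then show ?thesis by (simp add: C_def)
    qed
    have "norm (real (sdef I n)) \<le> (real C * (real D + 1) ^ (r - 2)) * norm (real n powi (int r - 2))"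
      if n: "n \<ge> 1" for n
    proof (cases "r < 2")
      case True
      then show ?thesis using le[OF n] C0 by simp
    next
      case False
      have "D * n + 1 \<le> (D + 1) * n" using n by simp
      then have "(D * n + 1) ^ (r - 2) \<le> ((D + 1) * n) ^ (r - 2)" by (rule power_mono) simp
      then have "C * (D * n + 1) ^ (r - 2) \<le> C * ((D + 1) * n) ^ (r - 2)" by simp
      then have "sdef I n \<le> C * ((D + 1) * n) ^ (r - 2)"
        using le[OF n] by linarith
      then have "real (sdef I n) \<le> real (C * ((D + 1) * n) ^ (r - 2))"
        by (simp only: of_nat_le_iff)
      also have "\<dots> = (real C * (real D + 1) ^ (r - 2)) * real n ^ (r - 2)"
        by (simp only: of_nat_mult of_nat_power of_nat_add of_nat_1 power_mult_distrib mult.assoc)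
      also have "real n ^ (r - 2) = real n powi (int r - 2)"
        using False by (simp add: power_int_def nat_diff_distrib)
      finally show ?thesis by simp
    qed
    then show ?thesis
      unfolding r_def by (intro bigoI eventually_sequentiallyI)
  qed
qed

end
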